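(* For all processes $P,Q$ of the calculus described in the context: $P$ and $Q$ are convertible ($P \bowtie Q$) if and only if $P\sim Q$.
   Context: Fix a countable set of actions $\alpha,\beta,\dots$. Finite processes: $F ::= 0 \mid \alpha.F \mid F|F$. Processes: $P ::= F \mid\ !\alpha.F \mid P|P$ (replication only on prefixed finite processes, at top level). Finite single-hole contexts: $D ::= [\,] \mid \alpha.D \mid D|F$; contexts: $C ::= D \mid\ !\alpha.D \mid C|P$; $C[F]$ is the result of filling the hole with the finite process $F$. Transitions: $\alpha.F\xrightarrow{\alpha}F$; $!\alpha.F\xrightarrow{\alpha}\ !\alpha.F|F$; if $P_1\xrightarrow{\alpha}P_1'$ then $P_1|P_2\xrightarrow{\alpha}P_1'|P_2$ and $P_2|P_1\xrightarrow{\alpha}P_2|P_1'$. Strong bisimilarity $\sim$ is the largest symmetric relation $\mathcal R$ such that $P\mathcal R Q$ and $P\xrightarrow{\alpha}P'$ imply $Q\xrightarrow{\alpha}Q'$ with $P'\mathcal R Q'$. $\equiv_D$ is the smallest congruence on processes containing the abelian monoid laws for $|$ with neutral element $0$ and the distribution law $\alpha.(F|\alpha.F|\cdots|\alpha.F)=\alpha.F|\alpha.F|\cdots|\alpha.F$ (with $k\ge0$ copies of $\alpha.F$ on the left and $k+1$ on the right). Rewriting: every process $T$ induces a relation $\to_T$ on processes, defined modulo $\equiv_D$ (on both sides) by the axioms (B1) $C[\alpha.F]\to_{T} C[0]$ whenever $T\equiv_D\ !\alpha.F|F'$ for some process $F'$ (here $C$ is any context and $F$ finite), and (B2) $!\alpha.F|\,!\alpha.F|P\to_T\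 !\alpha.F|P$ for any $T$. $\Rightarrow_T$ is the reflexive transitive closure of $\to_T$. $P$ and $Q$ are convertible, $P\bowtie Q$, if there is a process $T$ with $P\Rightarrow_T T$ and $Q\Rightarrow_T T$. *)

theory Defs
  imports Main "HOL-Library.Countable"
begin

text \<open>
  The grammars of finite processes and of processes overlap (a parallel composition of
  finite processes is generated by both), so both sorts are carved out of one type of raw terms.
\<close>

datatype 'a raw =
    Null
  | Pre 'a "'a raw"
  | Bang 'a "'a raw"
  | Par "'a raw" "'a raw"  (infixr "\<parallel>" 65)

inductive finite_process :: "'a raw \<Rightarrow> bool" where
  "finite_process Null"
| "finite_process F \<Longrightarrow> finite_process (Pre a F)"
| "finite_process F \<Longrightarrow> finite_process G \<Longrightarrow> finite_process (F \<parallel> G)"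

inductive process :: "'a raw \<Rightarrow> bool" where
  "finite_process F \<Longrightarrow> process F"
| "finite_process F \<Longrightarrow> process (Bang a F)"
| "process P \<Longrightarrow> process Q \<Longrightarrow> process (P \<parallel> Q)"

datatype 'a ctx =
    Hole
  | CPre 'a "'a ctx"
  | CBang 'a "'a ctx"
  | CPar "'a ctx" "'a raw"

inductive finite_context :: "'a ctx \<Rightarrow> bool" where
  "finite_context Hole"
| "finite_context D \<Longrightarrow> finite_context (CPre a D)"
| "finite_context D \<Longrightarrow> finite_process F \<Longrightarrow> finite_context (CPar D F)"

inductive process_context :: "'a ctx \<Rightarrow> bool" where
  "finite_context D \<Longrightarrow> process_context D"
| "finite_context D \<Longrightarrow> process_context (CBang a D)"
| "process_context C \<Longrightarrow> process P \<Longrightarrow> process_context (CPar C P)"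

primrec fill :: "'a ctx \<Rightarrow> 'a raw \<Rightarrow> 'a raw" where
  "fill Hole F = F"
| "fill (CPre a D) F = Pre a (fill D F)"
| "fill (CBang a D) F = Bang a (fill D F)"
| "fill (CPar C P) F = fill C F \<parallel> P"

inductive transition :: "'a raw \<Rightarrow> 'a \<Rightarrow> 'a raw \<Rightarrow> bool" where
  pre: "finite_process F \<Longrightarrow> transition (Pre a F) a F"
| bang: "finite_process F \<Longrightarrow> transition (Bang a F) a (Bang a F \<parallel> F)"
| par_left: "transition P a P' \<Longrightarrow> process Q \<Longrightarrow> transition (P \<parallel> Q) a (P' \<parallel> Q)"
| par_right: "transition P a P' \<Longrightarrow> process Q \<Longrightarrow> transition (Q \<parallel> P) a (Q \<parallel> P')"

definition bisimulation :: "('a raw \<Rightarrow> 'a raw \<Rightarrow> bool) \<Rightarrow> bool" where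
  "bisimulation R \<longleftrightarrow>
     (\<forall>P Q. R P Q \<longrightarrow> process P \<and> process Q) \<and>
     symp R \<and>
     (\<forall>P Q a P'. R P Q \<longrightarrow> transition P a P' \<longrightarrow> (\<exists>Q'. transition Q a Q' \<and> R P' Q'))"

definition bisimilar :: "'a raw \<Rightarrow> 'a raw \<Rightarrow> bool"  (infix "\<sim>" 50) where
  "P \<sim> Q \<longleftrightarrow> (\<exists>R. bisimulation R \<and> R P Q)"

lemma bisimulation_bisimilar: "bisimulation (\<sim>)"
  unfolding bisimulation_def
proof (intro conjI allI impI)
  show "symp (\<sim>)"
    by (rule sympI) (auto simp: bisimilar_def bisimulation_def dest: sympD)
next
  fix P Q a P'
  assume "P \<sim> Q" and step: "transition P a P'"
  then obtain R where R: "bisimulation R" "R P Q"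
    unfolding bisimilar_def by blast
  then obtain Q' where "transition Q a Q'" "R P' Q'"
    using step unfolding bisimulation_def by blast
  then show "\<exists>Q'. transition Q a Q' \<and> P' \<sim> Q'"
    using R(1) unfolding bisimilar_def by blast
qed (auto simp: bisimilar_def bisimulation_def)

lemma bisimulation_le_bisimilar: "bisimulation R \<Longrightarrow> R \<le> (\<sim>)"
  unfolding bisimilar_def by auto

text \<open>\<open>par_copies P Q k\<close> is \<open>P | Q | \<dots> | Q\<close> with \<open>k\<close> copies of \<open>Q\<close>.\<close>

primrec par_copies :: "'a raw \<Rightarrow> 'a raw \<Rightarrow> nat \<Rightarrow> 'a raw" where
  "par_copies P Q 0 = P"
| "par_copies P Q (Suc k) = par_copies P Q k \<parallel> Q"

inductive equivD :: "'a raw \<Rightarrow> 'a raw \<Rightarrow> bool"  (infix "\<equiv>\<^sub>D" 50) where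
  equiv_refl: "process P \<Longrightarrow> P \<equiv>\<^sub>D P"
| equiv_sym: "P \<equiv>\<^sub>D Q \<Longrightarrow> Q \<equiv>\<^sub>D P"
| equiv_trans: "P \<equiv>\<^sub>D Q \<Longrightarrow> Q \<equiv>\<^sub>D R \<Longrightarrow> P \<equiv>\<^sub>D R"
| cong_pre: "finite_process F \<Longrightarrow> finite_process G \<Longrightarrow> F \<equiv>\<^sub>D G \<Longrightarrow> Pre a F \<equiv>\<^sub>D Pre a G"
| cong_bang: "finite_process F \<Longrightarrow> finite_process G \<Longrightarrow> F \<equiv>\<^sub>D G \<Longrightarrow> Bang a F \<equiv>\<^sub>D Bang a G"
| cong_par: "P \<equiv>\<^sub>D P' \<Longrightarrow> Q \<equiv>\<^sub>D Q' \<Longrightarrow> P \<parallel> Q \<equiv>\<^sub>D P' \<parallel> Q'"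
| assoc: "process P \<Longrightarrow> process Q \<Longrightarrow> process R \<Longrightarrow> (P \<parallel> Q) \<parallel> R \<equiv>\<^sub>D P \<parallel> (Q \<parallel> R)"
| comm: "process P \<Longrightarrow> process Q \<Longrightarrow> P \<parallel> Q \<equiv>\<^sub>D Q \<parallel> P"
| neutral: "process P \<Longrightarrow> P \<parallel> Null \<equiv>\<^sub>D P"
| distrib: "finite_process F \<Longrightarrow>
    Pre a (par_copies F (Pre a F) k) \<equiv>\<^sub>D par_copies (Pre a F) (Pre a F) k"

inductive rewrite_step :: "'a raw \<Rightarrow> 'a raw \<Rightarrow> 'a raw \<Rightarrow> bool" for T :: "'a raw" where
  B1: "process_context C \<Longrightarrow> finite_process F \<Longrightarrow> process F' \<Longrightarrow> T \<equiv>\<^sub>D Bang a F \<parallel> F' \<Longrightarrow>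
    rewrite_step T (fill C (Pre a F)) (fill C Null)"
| B2: "process T \<Longrightarrow> finite_process F \<Longrightarrow> process P \<Longrightarrow>
    rewrite_step T (Bang a F \<parallel> Bang a F \<parallel> P) (Bang a F \<parallel> P)"
| mod_equivD: "P \<equiv>\<^sub>D P' \<Longrightarrow> rewrite_step T P' Q' \<Longrightarrow> Q' \<equiv>\<^sub>D Q \<Longrightarrow> rewrite_step T P Q"

text \<open>
  Rewriting lives on processes modulo \<open>\<equiv>\<^sub>D\<close>, so the reflexive closure is taken
  modulo \<open>\<equiv>\<^sub>D\<close> too: zero rewriting steps relate \<open>\<equiv>\<^sub>D\<close>-equivalent processes, not only
  syntactically equal ones.
\<close>

definition rewrite_star :: "'a raw \<Rightarrow> 'a raw \<Rightarrow> 'a raw \<Rightarrow> bool" where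
  "rewrite_star T = (\<lambda>P Q. P \<equiv>\<^sub>D Q \<or> rewrite_step T P Q)\<^sup>*\<^sup>*"

definition convertible :: "'a raw \<Rightarrow> 'a raw \<Rightarrow> bool"  (infix "\<bowtie>" 50) where
  "P \<bowtie> Q \<longleftrightarrow> (\<exists>T. process T \<and> rewrite_star T P T \<and> rewrite_star T Q T)"

end

theory Submission
  imports Defs "HOL-Library.Multiset"
begin

text \<open>
  Modulo the abelian monoid laws a process is a state (S, A): S is the set of its replicated prefixes
  and A the multiset of its remaining prefixes, i.e. a forest. Call a tree t absorbed by S if (S, {t})
  is bisimilar to (S, {}). Normalise a forest by hereditarily erasing the absorbed trees and applying
  the distribution law wherever possible. Every state reached from (S, A) that is bisimilar to (S, {})
  has an empty normal form, and no transition shrinks the normal form by more than one node; so its size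
  is the distance to the states bisimilar to (S, {}), hence a bisimulation invariant. Matching the
  size-decreasing transitions then shows that bisimilar forests over S have equal normal forms.
  If (S, A) and (R, B) are bisimilar, then so are (S, {}) and (R, {}), since a state is idempotent
  for parallel composition iff its normal form is empty; hence S and R absorb the same trees and have the
  same normalised replicated prefixes. The process T built from this common data is the required
  witness: an absorbed prefix reduces to one that is replicated in T, and there it is erased.
\<close>

subsection \<open>Bisimilarity of states\<close>

text \<open>A single step of \<open>rewrite_step T\<close> need not preserve bisimilarity:
  \<open>B1\<close> erases a prefix replicated in T, and the process being rewritten may lack that
  replication. Only a chain that ends in T is sound, so its steps are compared over the replicated
  prefixes of T (\<open>agree\<close>). Conversely, being absorbed by S is a semantic condition,
  while \<open>B1\<close> demands a syntactic match. The gap closes because an empty forest can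
  answer the move of an absorbed tree only through a replicated prefix: the two continuations are
  then equivalent over S and have equal normal forms. That a forest equivalent to the empty one has
  an empty normal form rests on cancellation: its trees are absorbed one by one
  (\<open>eqv_cancel_empty\<close>). Size counts nodes because the distribution law preserves their
  number: both sides have (k+1)(n+1) nodes if F has n. Being bisimilar to (S, {}) refers to S and
  cannot be transported directly to another set R; idempotence makes no such reference, which is why
  it serves to compare S and R.\<close>

datatype 'a tree = Node 'a "'a tree multiset"

text \<open>Equal copies of a replicated prefix offer the same moves, so a set suffices and
  \<open>B2\<close> becomes an identity of states. Continuations are forests, hence no move changes
  that set.\<close>

type_synonym 'a state = "('a \<times> 'a tree multiset) set \<times> 'a tree multiset"

definition step :: "'a state \<Rightarrow> 'a \<Rightarrow> 'a state \<Rightarrow> bool" where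
  "step p a q \<longleftrightarrow> fst q = fst p \<and>
     ((\<exists>N. Node a N \<in># snd p \<and> snd q = snd p - {#Node a N#} + N) \<or>
      (\<exists>N. (a, N) \<in> fst p \<and> snd q = snd p + N))"

coinductive bis :: "'a state \<Rightarrow> 'a state \<Rightarrow> bool" where
  "(\<And>a p'. step p a p' \<Longrightarrow> \<exists>q'. step q a q' \<and> bis p' q') \<Longrightarrow>
   (\<And>a q'. step q a q' \<Longrightarrow> \<exists>p'. step p a p' \<and> bis p' q') \<Longrightarrow> bis p q"

lemma bis_stepD1: "bis p q \<Longrightarrow> step p a p' \<Longrightarrow> \<exists>q'. step q a q' \<and> bis p' q'"
  by (erule bis.cases) blast

lemma bis_stepD2: "bis p q \<Longrightarrow> step q a q' \<Longrightarrow> \<exists>p'. step p a p' \<and> bis p' q'"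
  by (erule bis.cases) blast

lemma bis_coinductI:
  assumes "R p q"
    and fwd: "\<And>p q a p'. R p q \<Longrightarrow> step p a p' \<Longrightarrow> \<exists>q'. step q a q' \<and> R p' q'"
    and bwd: "\<And>p q a q'. R p q \<Longrightarrow> step q a q' \<Longrightarrow> \<exists>p'. step p a p' \<and> R p' q'"
  shows "bis p q"
  using assms(1)
proof (rule bis.coinduct)
  fix x y
  assume R: "R x y"
  have "\<forall>a p'. step x a p' \<longrightarrow> (\<exists>q'. step y a q' \<and> (R p' q' \<or> bis p' q'))"
    using fwd[OF R] by blast
  moreover have "\<forall>a q'. step y a q' \<longrightarrow> (\<exists>p'. step x a p' \<and> (R p' q' \<or> bis p' q'))"
    using bwd[OF R] by blast
  ultimately show "\<exists>p q. x = p \<and> y = q \<and>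
      (\<forall>a p'. step p a p' \<longrightarrow> (\<exists>q'. step q a q' \<and> (R p' q' \<or> bis p' q'))) \<and>
      (\<forall>a q'. step q a q' \<longrightarrow> (\<exists>p'. step p a p' \<and> (R p' q' \<or> bis p' q')))"
    by (intro exI[of _ x] exI[of _ y] conjI refl)
qed

lemma bis_refl [simp, intro]: "bis p p"
  by (rule bis_coinductI[of "(=)"]) auto

lemma bis_sym:
  assumes "bis p q"
  shows "bis q p"
  by (rule bis_coinductI[of "\<lambda>x y. bis y x"])
    (fact assms, (erule (1) bis_stepD2), (erule (1) bis_stepD1))

lemma bis_trans [trans]:
  assumes "bis p q" "bis q r"
  shows "bis p r"
proof (rule bis_coinductI[of "\<lambda>x z. \<exists>y. bis x y \<and> bis y z"])
  show "\<exists>y. bis p y \<and> bis y r" using assms by blast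
next
  fix p q a p' assume "\<exists>y. bis p y \<and> bis y q" "step p a p'"
  then show "\<exists>q'. step q a q' \<and> (\<exists>y. bis p' y \<and> bis y q')"
    using bis_stepD1[of p _ a p'] bis_stepD1[of _ q a] by metis
next
  fix p q a q' assume "\<exists>y. bis p y \<and> bis y q" "step q a q'"
  then show "\<exists>p'. step p a p' \<and> (\<exists>y. bis p' y \<and> bis y q')"
    using bis_stepD2[of _ q a q'] bis_stepD2[of p _ a] by metis
qed

lemma bis_upto:
  assumes "R p q"
    and fwd: "\<And>p q a p'. R p q \<Longrightarrow> step p a p' \<Longrightarrow>
      \<exists>q' u v. step q a q' \<and> bis p' u \<and> (R u v \<or> bis u v) \<and> bis v q'"
    and bwd: "\<And>p q a q'. R p q \<Longrightarrow> step q a q' \<Longrightarrow>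
      \<exists>p' u v. step p a p' \<and> bis p' u \<and> (R u v \<or> bis u v) \<and> bis v q'"
  shows "bis p q"
proof -
  define Q where "Q = (\<lambda>p q. \<exists>u v. bis p u \<and> (R u v \<or> bis u v) \<and> bis v q)"
  have Q_I: "Q p q" if "bis p p'" "bis p' u" "R u v \<or> bis u v" "bis v q'" "bis q' q" for p p' q q' u v
    using bis_trans[OF that(1,2)] bis_trans[OF that(4,5)] that(3) unfolding Q_def by blast
  have "Q p q" unfolding Q_def using assms(1) by blast
  then show ?thesis
  proof (rule bis_coinductI)
    fix p q a p' assume "Q p q" "step p a p'"
    then obtain u v where uv: "bis p u" "R u v \<or> bis u v" "bis v q"
      by (auto simp: Q_def)
    obtain u' where u': "step u a u'" "bis p' u'"
      using bis_stepD1[OF uv(1) \<open>step p a p'\<close>] by blast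
    obtain v' x y where v': "step v a v'" "bis u' x" "R x y \<or> bis x y" "bis y v'"
      using uv(2)
    proof
      assume "R u v" from fwd[OF this u'(1)] show thesis using that by blast
    next
      assume "bis u v" from bis_stepD1[OF this u'(1)] show thesis using that by blast
    qed
    obtain q' where "step q a q'" "bis v' q'"
      using bis_stepD1[OF uv(3) v'(1)] by blast
    then show "\<exists>q'. step q a q' \<and> Q p' q'"
      using Q_I[OF u'(2) v'(2-4)] by blast
  next
    fix p q a q' assume "Q p q" "step q a q'"
    then obtain u v where uv: "bis p u" "R u v \<or> bis u v" "bis v q"
      by (auto simp: Q_def)
    obtain v' where v': "step v a v'" "bis v' q'"
      using bis_stepD2[OF uv(3) \<open>step q a q'\<close>] by blast
    obtain u' x y where u': "step u a u'" "bis u' x" "R x y \<or> bis x y" "bis y v'"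
      using uv(2)
    proof
      assume "R u v" from bwd[OF this v'(1)] show thesis using that by blast
    next
      assume "bis u v" from bis_stepD2[OF this v'(1)] show thesis using that by blast
    qed
    obtain p' where "step p a p'" "bis p' u'"
      using bis_stepD2[OF uv(1) u'(1)] by blast
    then show "\<exists>p'. step p a p' \<and> Q p' q'"
      using Q_I[OF _ u'(2-4) v'(2)] by blast
  qed
qed

lemma step_fst: "step p a q \<Longrightarrow> fst q = fst p"
  by (simp add: step_def)

lemma step_par_iff:
  "step (S \<union> W, A + C) a (S \<union> W, Z) \<longleftrightarrow>
    (\<exists>A'. step (S, A) a (S, A') \<and> Z = A' + C) \<or> (\<exists>C'. step (W, C) a (W, C') \<and> Z = A + C')"
  (is "?L \<longleftrightarrow> ?R")
proof
  assume ?L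
  then consider N where "Node a N \<in># A" "Z = A + C - {#Node a N#} + N"
    | N where "Node a N \<in># C" "Z = A + C - {#Node a N#} + N"
    | N where "(a, N) \<in> S" "Z = A + C + N"
    | N where "(a, N) \<in> W" "Z = A + C + N"
    by (auto simp: step_def)
  then show ?R
  proof cases
    case 1
    then have "Z = (A - {#Node a N#} + N) + C"
      by (auto dest!: multi_member_split)
    with 1 show ?thesis by (auto simp: step_def)
  next
    case 2
    then have "Z = A + (C - {#Node a N#} + N)"
      by (auto dest!: multi_member_split)
    with 2 show ?thesis by (auto simp: step_def)
  next
    case 3
    then have "Z = (A + N) + C" by simp
    with 3 show ?thesis by (auto simp: step_def)
  next
    case 4
    then have "Z = A + (C + N)" by simp
    with 4 show ?thesis by (auto simp: step_def)
  qed
next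
  assume ?R
  then show ?L
    by (auto simp: step_def dest!: multi_member_split)
qed

lemma step_par_left: "step (S, A) a (S, A') \<Longrightarrow> step (S \<union> W, A + C) a (S \<union> W, A' + C)"
  by (auto simp: step_par_iff)

lemma step_par_right: "step (W, C) a (W, C') \<Longrightarrow> step (S \<union> W, A + C) a (S \<union> W, A + C')"
  by (auto simp: step_par_iff)

lemma step_par_cases:
  assumes "step (S \<union> W, A + C) a p"
  obtains A' where "step (S, A) a (S, A')" "p = (S \<union> W, A' + C)"
  | C' where "step (W, C) a (W, C')" "p = (S \<union> W, A + C')"
proof -
  obtain Z where "p = (S \<union> W, Z)"
    using step_fst[OF assms] by (cases p) auto
  with assms that show ?thesis by (auto simp: step_par_iff)
qed

lemma bis_step_obtain:
  assumes "bis (S, A) (R, B)" "step (S, A) a (S, A')"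
  obtains B' where "step (R, B) a (R, B')" "bis (S, A') (R, B')"
proof -
  obtain q' where q': "step (R, B) a q'" "bis (S, A') q'"
    using bis_stepD1[OF assms] by blast
  with step_fst[OF q'(1)] that[of "snd q'"] show ?thesis
    by (cases q') simp
qed

text \<open>The relation keeps \<open>W\<close> fixed and lets \<open>C\<close> vary, since a move
  of the shared context changes only its forest.\<close>

lemma bis_par:
  assumes "bis (S, A) (R, B)"
  shows "bis (S \<union> W, A + C) (R \<union> W, B + C)"
proof -
  define Q where "Q = (\<lambda>p q. \<exists>S R A B C. p = (S \<union> W, A + C) \<and> q = (R \<union> W, B + C) \<and> bis (S, A) (R, B))"
  have Q_I: "Q (S \<union> W, A + C) (R \<union> W, B + C)" if "bis (S, A) (R, B)" for S R A B C
    unfolding Q_def by (rule exI conjI refl that)+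
  have Q_sym: "Q q p" if "Q p q" for p q
  proof -
    obtain S R A B C where "p = (S \<union> W, A + C)" "q = (R \<union> W, B + C)" "bis (S, A) (R, B)"
      using \<open>Q p q\<close> unfolding Q_def by (elim exE conjE)
    then show ?thesis using Q_I[OF bis_sym] by simp
  qed
  have Q_step: "\<exists>q'. step q a q' \<and> Q p' q'" if "Q p q" "step p a p'" for p q a p'
  proof -
    obtain S R A B C where pq: "p = (S \<union> W, A + C)" "q = (R \<union> W, B + C)" and b: "bis (S, A) (R, B)"
      using \<open>Q p q\<close> unfolding Q_def by (elim exE conjE)
    from \<open>step p a p'\<close>[unfolded pq(1)] show ?thesis
    proof (cases rule: step_par_cases)
      case (1 A')
      obtain B' where "step (R, B) a (R, B')" "bis (S, A') (R, B')"
        using bis_step_obtain[OF b 1(1)] .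
      then have "step q a (R \<union> W, B' + C)" "Q p' (R \<union> W, B' + C)"
        unfolding pq(2) 1(2) by (simp_all add: step_par_left Q_I)
      then show ?thesis by blast
    next
      case (2 C')
      then have "step q a (R \<union> W, B + C')" "Q p' (R \<union> W, B + C')"
        unfolding pq(2) 2(2) by (simp_all add: step_par_right Q_I b)
      then show ?thesis by blast
    qed
  qed
  have Q_step': "\<exists>p'. step p a p' \<and> Q p' q'" if "Q p q" "step q a q'" for p q a q'
    using Q_step[OF Q_sym[OF that(1)] that(2)] Q_sym by blast
  show ?thesis
    using Q_I[OF assms] by (rule bis_coinductI) (fact Q_step Q_step')+
qed

section \<open>Equivalence of forests over a fixed set of replicated prefixes\<close>

definition eqv :: "('a \<times> 'a tree multiset) set \<Rightarrow> 'a tree multiset \<Rightarrow> 'a tree multiset \<Rightarrow> bool" where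
  "eqv S X Y \<longleftrightarrow> bis (S, X) (S, Y)"

lemma eqv_refl [simp, intro]: "eqv S X X"
  by (simp add: eqv_def)

lemma eqv_sym: "eqv S X Y \<Longrightarrow> eqv S Y X"
  by (simp add: eqv_def bis_sym)

lemma eqv_trans [trans]: "eqv S X Y \<Longrightarrow> eqv S Y Z \<Longrightarrow> eqv S X Z"
  unfolding eqv_def by (rule bis_trans)

lemma eqv_add_right: "eqv S X Y \<Longrightarrow> eqv S (X + Z) (Y + Z)"
  unfolding eqv_def using bis_par[of S X S Y "{}" Z] by simp

lemma eqv_add:
  assumes "eqv S X Y" "eqv S X' Y'"
  shows "eqv S (X + X') (Y + Y')"
proof -
  have "eqv S (X + X') (Y + X')" using assms(1) by (rule eqv_add_right)
  also have "eqv S (Y + X') (Y + Y')"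
    using eqv_add_right[OF assms(2), of Y] by (simp add: union_commute)
  finally show ?thesis .
qed

lemma eqv_stepD:
  assumes "eqv S X Y" "step (S, X) a (S, X')"
  obtains Y' where "step (S, Y) a (S, Y')" "eqv S X' Y'"
  using bis_step_obtain[OF assms(1)[unfolded eqv_def] assms(2)] that unfolding eqv_def by blast

lemma step_par_state_cases:
  assumes "step (S, Z + X) a p"
  obtains Z' where "step (S, Z) a (S, Z')" "p = (S, Z' + X)"
  | X' where "step ({}, X) a ({}, X')" "p = (S, Z + X')"
  using step_par_cases[of S "{}" Z X a p] assms by auto

text \<open>Moves of \<open>S\<close> go into a spectator forest \<open>Z\<close> that both sides
  carry along. So only the moves of the two forests by themselves have to be matched, while the
  answers may use \<open>S\<close>; after such a move the successors are equivalent by hypothesis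
  and \<open>bis_upto\<close> lets the proof leave the relation.\<close>

lemma eqv_intro:
  assumes "\<And>a X'. step ({}, X) a ({}, X') \<Longrightarrow> \<exists>Y'. step (S, Y) a (S, Y') \<and> eqv S X' Y'"
    and "\<And>a Y'. step ({}, Y) a ({}, Y') \<Longrightarrow> \<exists>X'. step (S, X) a (S, X') \<and> eqv S X' Y'"
  shows "eqv S X Y"
proof -
  let ?R = "\<lambda>p q. \<exists>Z. p = (S, Z + X) \<and> q = (S, Z + Y)"
  have "?R (S, {#} + X) (S, {#} + Y)" by blast
  then have "bis (S, {#} + X) (S, {#} + Y)"
  proof (rule bis_upto)
    fix p q a p'
    assume "?R p q" "step p a p'"
    then obtain Z where Z: "p = (S, Z + X)" "q = (S, Z + Y)" by blast
    from \<open>step p a p'\<close>[unfolded Z]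
    show "\<exists>q' u v. step q a q' \<and> bis p' u \<and> (?R u v \<or> bis u v) \<and> bis v q'"
    proof (cases rule: step_par_state_cases)
      case (1 Z')
      then have "step q a (S, Z' + Y)" "?R p' (S, Z' + Y)"
        using step_par_left[of S Z a Z' "{}" Y] Z by auto
      then show ?thesis by blast
    next
      case (2 X')
      then obtain Y' where Y': "step (S, Y) a (S, Y')" "eqv S X' Y'" using assms(1) by blast
      have "step q a (S, Z + Y')"
        using step_par_right[OF Y'(1), of "{}" Z] Z by simp
      moreover have "bis p' (S, Z + Y')"
        using eqv_add[OF eqv_refl Y'(2), of Z] 2 by (simp add: eqv_def)
      ultimately show ?thesis by blast
    qed
  next
    fix p q a q'
    assume "?R p q" "step q a q'"
    then obtain Z where Z: "p = (S, Z + X)" "q = (S, Z + Y)" by blast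
    from \<open>step q a q'\<close>[unfolded Z]
    show "\<exists>p' u v. step p a p' \<and> bis p' u \<and> (?R u v \<or> bis u v) \<and> bis v q'"
    proof (cases rule: step_par_state_cases)
      case (1 Z')
      then have "step p a (S, Z' + X)" "?R (S, Z' + X) q'"
        using step_par_left[of S Z a Z' "{}" X] Z by auto
      then show ?thesis by blast
    next
      case (2 Y')
      then obtain X' where X': "step (S, X) a (S, X')" "eqv S X' Y'" using assms(2) by blast
      have "step p a (S, Z + X')"
        using step_par_right[OF X'(1), of "{}" Z] Z by simp
      moreover have "bis (S, Z + X') q'"
        using eqv_add[OF eqv_refl X'(2), of Z] 2 by (simp add: eqv_def)
      ultimately show ?thesis by blast
    qed
  qed
  then show ?thesis by (simp add: eqv_def)
qed

lemma step_replicate_iff: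
  "step ({}, replicate_mset (Suc k) (Node a N)) b ({}, Z) \<longleftrightarrow>
     b = a \<and> Z = N + replicate_mset k (Node a N)"
  by (auto simp: step_def union_commute)

lemma step_Node_iff: "step ({}, {#Node a N#}) b ({}, Z) \<longleftrightarrow> b = a \<and> Z = N"
  using step_replicate_iff[of 0] by simp

lemma step_Node: "Node a N \<in># X \<Longrightarrow> step (S, X) a (S, X - {#Node a N#} + N)"
  by (auto simp: step_def)

lemma step_Bang: "(a, N) \<in> S \<Longrightarrow> step (S, X) a (S, X + N)"
  by (auto simp: step_def)

lemma eqv_Node:
  assumes "eqv S X Y"
  shows "eqv S {#Node a X#} {#Node a Y#}"
proof (rule eqv_intro)
  fix b X' assume "step ({}, {#Node a X#}) b ({}, X')"
  then show "\<exists>Y'. step (S, {#Node a Y#}) b (S, Y') \<and> eqv S X' Y'"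
    using step_Node[of a Y "{#Node a Y#}"] assms by (intro exI[of _ Y]) (simp add: step_Node_iff)
next
  fix b Y' assume "step ({}, {#Node a Y#}) b ({}, Y')"
  then show "\<exists>X'. step (S, {#Node a X#}) b (S, X') \<and> eqv S X' Y'"
    using step_Node[of a X "{#Node a X#}"] assms by (intro exI[of _ X]) (simp add: step_Node_iff)
qed

text \<open>Both sides have the same only successor: the single prefix releases \<open>N\<close> and
  k copies, while firing one of k+1 copies leaves k of them and adds \<open>N\<close>.\<close>

lemma eqv_distrib:
  "eqv S {#Node a (N + replicate_mset k (Node a N))#} (replicate_mset (Suc k) (Node a N))"
  (is "eqv S {#Node a ?M#} ?C")
proof (rule eqv_intro)
  fix b X' assume "step ({}, {#Node a ?M#}) b ({}, X')"
  then show "\<exists>Y'. step (S, ?C) b (S, Y') \<and> eqv S X' Y'"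
    using step_Node[of a N ?C S] by (intro exI[of _ ?M]) (simp add: step_Node_iff union_commute)
next
  fix b Y' assume "step ({}, ?C) b ({}, Y')"
  then show "\<exists>X'. step (S, {#Node a ?M#}) b (S, X') \<and> eqv S X' Y'"
    using step_Node[of a ?M "{#Node a ?M#}" S]
    by (intro exI[of _ ?M]) (simp only: step_replicate_iff, simp)
qed

lemma eqv_absorb:
  assumes "(a, N) \<in> S"
  shows "eqv S {#Node a N#} {#}"
proof (rule eqv_intro)
  fix b X' assume "step ({}, {#Node a N#}) b ({}, X')"
  then show "\<exists>Y'. step (S, {#}) b (S, Y') \<and> eqv S X' Y'"
    using step_Bang[OF assms, of "{#}"] by (intro exI[of _ N]) (simp add: step_Node_iff)
qed (simp add: step_def)

text \<open>If one part \<open>Z\<close> of \<open>X + Y\<close> moves to \<open>Z'\<close>, add the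
  other part \<open>W\<close>: the whole is equivalent to nothing, so \<open>V\<close> alone
  answers, with a result bisimilar to \<open>V + Z' + W\<close>. This exceeds \<open>V + Z'\<close>
  by \<open>W\<close>, on the opposite side, so the relation has to contain both parts and both
  orientations.\<close>

lemma eqv_cancel_empty:
  assumes "eqv S (X + Y) {#}"
  shows "eqv S X {#}"
proof -
  define R where "R = (\<lambda>p q. \<exists>V Z. (Z = X \<or> Z = Y) \<and>
    (p = (S, V + Z) \<and> q = (S, V) \<or> p = (S, V) \<and> q = (S, V + Z)))"
  have R_I: "R (S, V + Z) (S, V)" "R (S, V) (S, V + Z)" if "Z = X \<or> Z = Y" for V Z
    unfolding R_def using that by auto
  have R_sym: "R q p" if "R p q" for p q
    using that unfolding R_def by auto
  have abs: "bis (S, V + (X + Y)) (S, V)" for V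
    using eqv_add[OF eqv_refl assms, of V] by (simp add: eqv_def)
  have erase: "\<exists>q' v. step (S, V) a q' \<and> R p' v \<and> bis v q'"
    if Z: "Z = X \<or> Z = Y" and st: "step (S, V + Z) a p'" for V Z a p'
    using st
  proof (cases rule: step_par_state_cases)
    case (1 V')
    then show ?thesis using R_I(1)[OF Z] bis_refl by blast
  next
    case (2 Z')
    obtain W where W: "X + Y = Z + W" "W = X \<or> W = Y"
      using Z by (auto simp: union_commute)
    have "step (S, V + Z) a (S, V + Z')"
      using step_par_right[OF 2(1), of S V] by simp
    then have "step (S, V + (X + Y)) a (S, V + Z' + W)"
      using step_par_left[of S "V + Z" a "V + Z'" "{}" W] by (simp add: W(1) add.assoc)
    then obtain q' where "step (S, V) a q'" "bis (S, V + Z' + W) q'"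
      using bis_stepD1[OF abs] by blast
    then show ?thesis using R_I(2)[OF W(2)] 2(2) by blast
  qed
  have keep: "\<exists>q'. step (S, V + Z) a q' \<and> R p' q'"
    if Z: "Z = X \<or> Z = Y" and st: "step (S, V) a p'" for V Z a p'
  proof -
    obtain V' where V': "p' = (S, V')" using step_fst[OF st] by (cases p') auto
    then have "step (S, V + Z) a (S, V' + Z)"
      using step_par_left[of S V a V' "{}" Z] st by simp
    then show ?thesis using V' R_I(2)[OF Z] by blast
  qed
  have main: "\<exists>q' v. step q a q' \<and> R p' v \<and> bis v q'" if "R p q" "step p a p'" for p q a p'
  proof -
    obtain V Z where Z: "Z = X \<or> Z = Y"
      and "p = (S, V + Z) \<and> q = (S, V) \<or> p = (S, V) \<and> q = (S, V + Z)"
      using \<open>R p q\<close> unfolding R_def by (elim exE conjE)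
    from this(2) show ?thesis
    proof (elim disjE conjE)
      assume "p = (S, V + Z)" "q = (S, V)"
      then show ?thesis using erase[OF Z] \<open>step p a p'\<close> by simp
    next
      assume "p = (S, V)" "q = (S, V + Z)"
      then show ?thesis using keep[OF Z] \<open>step p a p'\<close> bis_refl by blast
    qed
  qed
  have "bis (S, {#} + X) (S, {#})"
  proof (rule bis_upto[of R])
    show "R (S, {#} + X) (S, {#})" by (rule R_I) simp
  next
    fix p q a p'
    assume "R p q" "step p a p'"
    then show "\<exists>q' u v. step q a q' \<and> bis p' u \<and> (R u v \<or> bis u v) \<and> bis v q'"
      using main[of p q a p'] bis_refl by blast
  next
    fix p q a q'
    assume "R p q" "step q a q'"
    then obtain p' v where "step p a p'" "R q' v" "bis v p'"
      using main[of q p a q'] R_sym[of p q] by blast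
    then show "\<exists>p' u v. step p a p' \<and> bis p' u \<and> (R u v \<or> bis u v) \<and> bis v q'"
      using R_sym[of q' v] bis_sym[of v p'] bis_refl[of q'] by blast
  qed
  then show ?thesis by (simp add: eqv_def)
qed

lemma step_cases:
  assumes "step (S, A) a p"
  obtains B where "p = (S, A - {#Node a B#} + B)" "Node a B \<in># A"
  | B where "p = (S, A + B)" "(a, B) \<in> S"
  using assms by (cases p) (auto simp: step_def)

text \<open>Equivalence over \<open>N\<close> is enough: when the two sides release different
  continuations, the difference is repaired, up to \<open>bis\<close>, on the side that carries
  \<open>N\<close>.\<close>

lemma bis_rel_set:
  fixes M N :: "('a \<times> 'a tree multiset) set"
  assumes fwd: "\<And>a X. (a, X) \<in> M \<Longrightarrow> \<exists>Y. (a, Y) \<in> N \<and> eqv N X Y"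
    and bwd: "\<And>a Y. (a, Y) \<in> N \<Longrightarrow> \<exists>X. (a, X) \<in> M \<and> eqv N X Y"
  shows "bis (M, A) (N, A)"
proof -
  define R where "R = (\<lambda>p q. \<exists>A :: 'a tree multiset. p = (M, A) \<and> q = (N, A))"
  have R_I: "R (M, A) (N, A)" for A by (auto simp: R_def)
  have "R (M, A) (N, A)" by (rule R_I)
  then show ?thesis
  proof (rule bis_upto)
    fix p q a p'
    assume "R p q" and st: "step p a p'"
    then obtain A where A: "p = (M, A)" "q = (N, A)" by (auto simp: R_def)
    from st[unfolded A(1)] show "\<exists>q' u v. step q a q' \<and> bis p' u \<and> (R u v \<or> bis u v) \<and> bis v q'"
    proof (cases rule: step_cases)
      case (1 B)
      have "step q a (N, A - {#Node a B#} + B)" using step_Node[OF 1(2)] A(2) by simp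
      then show ?thesis using R_I[of "A - {#Node a B#} + B"] bis_refl 1(1) by blast
    next
      case (2 B)
      obtain Y where Y: "(a, Y) \<in> N" "eqv N B Y" using fwd[OF 2(2)] by blast
      have "step q a (N, A + Y)" using step_Bang[OF Y(1)] A(2) by simp
      moreover have "bis (N, A + B) (N, A + Y)" using eqv_add[OF eqv_refl Y(2)] by (simp add: eqv_def)
      ultimately show ?thesis using R_I[of "A + B"] bis_refl 2(1) by blast
    qed
  next
    fix p q a q'
    assume "R p q" and st: "step q a q'"
    then obtain A where A: "p = (M, A)" "q = (N, A)" by (auto simp: R_def)
    from st[unfolded A(2)] show "\<exists>p' u v. step p a p' \<and> bis p' u \<and> (R u v \<or> bis u v) \<and> bis v q'"
    proof (cases rule: step_cases)
      case (1 B)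
      have "step p a (M, A - {#Node a B#} + B)" using step_Node[OF 1(2)] A(1) by simp
      then show ?thesis using R_I[of "A - {#Node a B#} + B"] bis_refl 1(1) by blast
    next
      case (2 B)
      obtain X where X: "(a, X) \<in> M" "eqv N X B" using bwd[OF 2(2)] by blast
      have "step p a (M, A + X)" using step_Bang[OF X(1)] A(1) by simp
      moreover have "bis (N, A + X) (N, A + B)" using eqv_add[OF eqv_refl X(2)] by (simp add: eqv_def)
      ultimately show ?thesis using R_I[of "A + X"] bis_refl 2(1) by blast
    qed
  qed
qed

subsection \<open>Irreducible trees\<close>

primrec tsize :: "'a tree \<Rightarrow> nat" where
  "tsize (Node a N) = Suc (sum_mset (image_mset tsize N))"

abbreviation msize :: "'a tree multiset \<Rightarrow> nat" where
  "msize N \<equiv> \<Sum>t\<in>#N. tsize t"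

primrec kids :: "'a tree \<Rightarrow> 'a tree multiset" where
  "kids (Node a N) = N"

primrec label :: "'a tree \<Rightarrow> 'a" where
  "label (Node a N) = a"

text \<open>\<open>Suc k\<close> because the distribution law with no copy on the left is an
  identity and must not count as a reduction.\<close>

primrec irreducible :: "'a tree \<Rightarrow> bool" where
  "irreducible (Node a M) \<longleftrightarrow> (\<forall>b\<in>#image_mset irreducible M. b) \<and>
     (\<forall>N k. M \<noteq> N + replicate_mset (Suc k) (Node a N))"

text \<open>
  Choosing N irreducible whenever possible makes \<open>prefix_nf a M\<close> the prime decomposition of the
  prefix of M by a under the distribution law.
\<close>

definition prefix_nf :: "'a \<Rightarrow> 'a tree multiset \<Rightarrow> 'a tree multiset" where
  "prefix_nf a M = (SOME X. \<exists>N k. M = N + replicate_mset k (Node a N) \<and>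
     X = replicate_mset (Suc k) (Node a N) \<and>
     ((\<forall>t\<in>#M. irreducible t) \<longrightarrow> irreducible (Node a N)))"

text \<open>If \<open>M\<close> splits with at least one copy, the copied tree lies in
  \<open>M\<close> and is irreducible along with it; otherwise \<open>Node a M\<close> is
  irreducible by definition. One use of the law therefore suffices.\<close>

lemma prefix_nf_cases:
  obtains N k where "M = N + replicate_mset k (Node a N)"
    "prefix_nf a M = replicate_mset (Suc k) (Node a N)"
    "(\<forall>t\<in>#M. irreducible t) \<Longrightarrow> irreducible (Node a N)"
proof -
  let ?P = "\<lambda>X. \<exists>N k. M = N + replicate_mset k (Node a N) \<and>
     X = replicate_mset (Suc k) (Node a N) \<and>
     ((\<forall>t\<in>#M. irreducible t) \<longrightarrow> irreducible (Node a N))"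
  have "\<exists>X. ?P X"
  proof (cases "\<exists>N k. M = N + replicate_mset (Suc k) (Node a N)")
    case True
    then obtain N k where M: "M = N + replicate_mset (Suc k) (Node a N)" by blast
    then have "Node a N \<in># M" by simp
    then have "(\<forall>t\<in>#M. irreducible t) \<longrightarrow> irreducible (Node a N)" by blast
    with M have "?P (replicate_mset (Suc (Suc k)) (Node a N))"
      by (intro exI[of _ N] exI[of _ "Suc k"] conjI refl)
    then show ?thesis by (rule exI)
  next
    case False
    then have "(\<forall>t\<in>#M. irreducible t) \<longrightarrow> irreducible (Node a M)" by simp
    then have "?P (replicate_mset (Suc 0) (Node a M))"
      by (intro exI[of _ M] exI[of _ 0] conjI refl) simp_all
    then show ?thesis by (rule exI)
  qed
  then have "?P (prefix_nf a M)" unfolding prefix_nf_def by (rule someI_ex)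
  then obtain N k where "M = N + replicate_mset k (Node a N)"
    "prefix_nf a M = replicate_mset (Suc k) (Node a N)"
    "(\<forall>t\<in>#M. irreducible t) \<longrightarrow> irreducible (Node a N)"
    by (elim exE conjE)
  then show thesis using that[of N k] by simp
qed

lemma tsize_less: "s \<in># kids t \<Longrightarrow> tsize s < tsize t"
  by (cases t) (auto dest!: multi_member_split)

lemma msize_prefix_nf: "msize (prefix_nf a M) = Suc (msize M)"
  by (rule prefix_nf_cases[of M a]) (simp add: algebra_simps)

text \<open>
  A tree t of maximal size whose multiplicity is larger in M can only be compensated by firing t itself,
  which forces M to be t alone; then N consists of copies of a single tree, so t is reducible unless N is t.
\<close>

lemma irreducible_multiset_eqI_aux:
  fixes M N :: "'a tree multiset"
  assumes fwd: "\<And>u. u \<in># M \<Longrightarrow> \<exists>s\<in>#N. label s = label u \<and> M - {#u#} + kids u = N - {#s#} + kids s"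
    and bwd: "\<And>s. s \<in># N \<Longrightarrow> \<exists>u\<in>#M. label s = label u \<and> M - {#u#} + kids u = N - {#s#} + kids s"
    and irr: "\<And>u. u \<in># M \<Longrightarrow> irreducible u"
    and t: "count M t > count N t"
    and max: "\<And>s. count M s \<noteq> count N s \<Longrightarrow> tsize s \<le> tsize t"
  shows False
proof -
  have only: "u = t \<and> s \<noteq> t \<and> count M t = Suc (count N t)"
    if us: "u \<in># M" "s \<in># N" "M - {#u#} + kids u = N - {#s#} + kids s" for u s
  proof -
    have eq: "count M z + count (kids u) z + (if z = s then 1 else 0) =
        count N z + count (kids s) z + (if z = u then 1 else 0)" for z
    proof -
      have "M + kids u + {#s#} = N + kids s + {#u#}"
        using us by (auto dest!: multi_member_split simp: add_mset_commute)
      then have "count (M + kids u + {#s#}) z = count (N + kids s + {#u#}) z" by simp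
      then show ?thesis by (cases "z = s"; cases "z = u") auto
    qed
    \<comment> \<open>Kids are strictly smaller than their parent, so they do not disturb the
      balance \<open>eq\<close> at any tree at least as large as that parent.\<close>
    have nokid: "count (kids x) y = 0" if "tsize x \<le> tsize y" for x y :: "'a tree"
      using tsize_less[of y x] that by (meson leD not_in_iff)
    have ne: "s \<noteq> u"
    proof
      assume "s = u"
      with eq[of t] t show False by simp
    qed
    \<comment> \<open>The larger of \<open>s\<close> and \<open>u\<close> is a kid of neither, so
      \<open>eq\<close> makes its multiplicities differ and the maximality of \<open>t\<close>
      bounds it.\<close>
    have small: "tsize s \<le> tsize t \<and> tsize u \<le> tsize t"
    proof (cases "tsize u \<le> tsize s")
      case True
      with eq[of s] ne nokid[of u s] nokid[of s s] have "count M s \<noteq> count N s" by simp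
      with max[of s] True show ?thesis by simp
    next
      case False
      with eq[of u] ne nokid[of s u] nokid[of u u] have "count M u \<noteq> count N u" by simp
      with max[of u] False show ?thesis by simp
    qed
    \<comment> \<open>At \<open>t\<close> no kids interfere any more: its surplus in
      \<open>M\<close> can only come from \<open>u = t\<close>, and it is exactly one.\<close>
    with eq[of t] nokid[of u t] nokid[of s t] t ne show ?thesis by (auto split: if_splits)
  qed
  have "t \<in># M" using t by (cases "t \<in># M") (auto simp: not_in_iff)
  then obtain s where s: "s \<in># N" "label s = label t" "M - {#t#} + kids t = N - {#s#} + kids s"
    using fwd by blast
  have "t \<notin># N"
  proof
    assume "t \<in># N"
    from bwd[OF this] only[OF _ this] show False by auto
  qed
  then have "count M t = 1" using only[OF \<open>t \<in># M\<close> s(1,3)] by (simp add: not_in_iff)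
  moreover have "u = t" if "u \<in># M" for u
    using fwd[OF that] only[OF that] by blast
  ultimately have M: "M = {#t#}"
    by (intro multiset_eqI) (metis count_single not_in_iff)
  have kt: "kids t = N - {#s'#} + kids s'" if "s' \<in># N" for s'
    using bwd[OF that] by (auto simp: M)
  \<comment> \<open>Firing \<open>s'\<close> lowers its own multiplicity, while firing a different
    \<open>s''\<close> that is no larger leaves at least as many copies of \<open>s'\<close>. Both
    residuals equal \<open>kids t\<close>, so the trees of \<open>N\<close> cannot differ.\<close>
  have all: "s' = s''" if "s' \<in># N" "s'' \<in># N" "tsize s'' \<le> tsize s'" for s' s''
  proof (rule ccontr)
    assume "s' \<noteq> s''"
    have "count (N - {#s'#} + kids s') s' = count (N - {#s''#} + kids s'') s'"
      using kt that by metis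
    moreover have "s' \<notin># kids s'" "s' \<notin># kids s''"
      using tsize_less[of s' s'] tsize_less[of s' s''] that(3) by auto
    ultimately show False using \<open>s' \<noteq> s''\<close> that(1)
      by (simp add: not_in_iff count_greater_zero_iff[symmetric] del: count_greater_zero_iff)
  qed
  then have "\<forall>s'\<in>#N. s' = s" using s(1) by (metis linear)
  then have N: "N = replicate_mset (size N) s"
    using set_mset_subset_singletonD[of N s] by auto
  obtain k where k: "size N = Suc k" using s(1) by (metis gr0_implies_Suc nonempty_has_size empty_iff set_mset_empty)
  obtain a B where sB: "s = Node a B" by (cases s)
  obtain C where tC: "t = Node a C" using s(2) sB by (cases t) auto
  have C: "C = B + replicate_mset k (Node a B)"
    using kt[OF s(1)] N k by (simp add: sB tC union_commute)
  have "irreducible t" using irr \<open>t \<in># M\<close> .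
  then have "k = 0" using C tC by (cases k) auto
  then have "s = t" using C sB tC by simp
  with \<open>t \<notin># N\<close> s(1) show False by simp
qed

lemma irreducible_multiset_eqI:
  fixes M N :: "'a tree multiset"
  assumes fwd: "\<And>u. u \<in># M \<Longrightarrow> \<exists>s\<in>#N. label s = label u \<and> M - {#u#} + kids u = N - {#s#} + kids s"
    and bwd: "\<And>s. s \<in># N \<Longrightarrow> \<exists>u\<in>#M. label s = label u \<and> M - {#u#} + kids u = N - {#s#} + kids s"
    and irr: "\<And>u. u \<in># M \<Longrightarrow> irreducible u" "\<And>s. s \<in># N \<Longrightarrow> irreducible s"
  shows "M = N"
proof (rule ccontr)
  assume "M \<noteq> N"
  then have ne: "{s. count M s \<noteq> count N s} \<noteq> {}" by (auto simp: multiset_eq_iff)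
  have "{s. count M s \<noteq> count N s} \<subseteq> set_mset M \<union> set_mset N"
    by (auto simp: not_in_iff)
  then have fin: "finite {s. count M s \<noteq> count N s}" by (rule finite_subset) simp
  obtain t where t: "count M t \<noteq> count N t"
    and max: "\<And>s. count M s \<noteq> count N s \<Longrightarrow> tsize s \<le> tsize t"
  proof -
    let ?D = "{s. count M s \<noteq> count N s}"
    have "Max (tsize ` ?D) \<in> tsize ` ?D" using ne fin by simp
    then obtain t where "t \<in> ?D" "tsize t = Max (tsize ` ?D)" by auto
    then show thesis using that[of t] fin by simp
  qed
  consider "count M t > count N t" | "count N t > count M t" using t by linarith
  then show False
  proof cases
    case 1
    show False
      by (rule irreducible_multiset_eqI_aux[OF fwd bwd irr(1) 1 max])
  next
    case 2
    show False
    proof (rule irreducible_multiset_eqI_aux[OF _ _ irr(2) 2])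
      show "\<exists>s\<in>#M. label s = label u \<and> N - {#u#} + kids u = M - {#s#} + kids s"
        if "u \<in># N" for u using bwd[OF that] by metis
      show "\<exists>u\<in>#N. label s = label u \<and> N - {#u#} + kids u = M - {#s#} + kids s"
        if "s \<in># M" for s using fwd[OF that] by metis
    qed (use max in auto)
  qed
qed

subsection \<open>Normal forms of forests\<close>

definition absorbed :: "('a \<times> 'a tree multiset) set \<Rightarrow> 'a tree set" where
  "absorbed S = {t. eqv S {#t#} {#}}"

text \<open>With the erased set \<open>E\<close> as a parameter, states with different replicated
  prefixes share one normalisation, and rewriting can be treated without reference to
  \<open>bis\<close>.\<close>

primrec norm_tree :: "'a tree set \<Rightarrow> 'a tree \<Rightarrow> 'a tree multiset" where
  "norm_tree E (Node a N) =
    (if Node a N \<in> E then {#} else prefix_nf a (\<Sum>\<^sub># (image_mset (norm_tree E) N)))"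

definition norm_forest :: "'a tree set \<Rightarrow> 'a tree multiset \<Rightarrow> 'a tree multiset" where
  "norm_forest E M = (\<Sum>t\<in>#M. norm_tree E t)"

lemma norm_simps [simp]:
  "norm_forest E {#} = {#}"
  "norm_forest E (add_mset t M) = norm_tree E t + norm_forest E M"
  "norm_forest E (M + N) = norm_forest E M + norm_forest E N"
  by (simp_all add: norm_forest_def)

lemma norm_tree_Node: "norm_tree E (Node a N) = (if Node a N \<in> E then {#} else prefix_nf a (norm_forest E N))"
  by (simp add: norm_forest_def)

declare norm_tree.simps [simp del]

lemma irreducible_prefix_nf:
  "(\<And>t. t \<in># M \<Longrightarrow> irreducible t) \<Longrightarrow> t \<in># prefix_nf a M \<Longrightarrow> irreducible t"
  by (rule prefix_nf_cases[of M a]) (auto split: if_splits)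

lemma norm_tree_irreducible: "s \<in># norm_tree E t \<Longrightarrow> irreducible s"
proof (induction t arbitrary: s)
  case (Node a N)
  have "irreducible u" if "u \<in># norm_forest E N" for u
    using that Node.IH by (auto simp: norm_forest_def)
  then show ?case
    using Node.prems irreducible_prefix_nf[of "norm_forest E N" s a] by (simp add: norm_tree_Node split: if_splits)
qed

lemma norm_irreducible: "s \<in># norm_forest E M \<Longrightarrow> irreducible s"
  using norm_tree_irreducible by (auto simp: norm_forest_def)

lemma eqv_prefix_nf: "eqv S {#Node a M#} (prefix_nf a M)"
proof -
  obtain N k where M: "M = N + replicate_mset k (Node a N)"
    and nf: "prefix_nf a M = replicate_mset (Suc k) (Node a N)"
    by (rule prefix_nf_cases[of M a])
  show ?thesis unfolding nf by (subst M) (rule eqv_distrib)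
qed

lemma eqv_norm_aux: "(\<And>t. t \<in># X \<Longrightarrow> eqv S {#t#} (norm_tree E t)) \<Longrightarrow> eqv S X (norm_forest E X)"
proof (induction X)
  case (add t X)
  then show ?case using eqv_add[of S "{#t#}" "norm_tree E t" X "norm_forest E X"] by simp
qed simp

text \<open>Erasing below a prefix is sound because \<open>S\<close> persists along all moves, so
  equivalence over \<open>S\<close> is preserved by \<open>Node\<close>.\<close>

lemma eqv_norm_tree: "eqv S {#t#} (norm_tree (absorbed S) t)"
proof (induction t)
  case (Node a N)
  show ?case
  proof (cases "Node a N \<in> absorbed S")
    case True
    then show ?thesis by (simp add: norm_tree_Node absorbed_def)
  next
    case False
    have "eqv S N (norm_forest (absorbed S) N)" using Node eqv_norm_aux by blast
    then have "eqv S {#Node a N#} {#Node a (norm_forest (absorbed S) N)#}" by (rule eqv_Node)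
    also have "eqv S \<dots> (prefix_nf a (norm_forest (absorbed S) N))" by (rule eqv_prefix_nf)
    finally show ?thesis using False by (simp add: norm_tree_Node)
  qed
qed

lemma eqv_norm: "eqv S X (norm_forest (absorbed S) X)"
  by (rule eqv_norm_aux) (rule eqv_norm_tree)

lemma norm_tree_absorbed: "t \<in> E \<Longrightarrow> norm_tree E t = {#}"
  by (cases t) (simp add: norm_tree_Node)

text \<open>From right to left this is cancellation: each single tree of \<open>X\<close> is
  absorbed, hence erased at its root.\<close>

lemma norm_empty_iff: "norm_forest (absorbed S) X = {#} \<longleftrightarrow> eqv S X {#}"
proof
  assume "norm_forest (absorbed S) X = {#}"
  then show "eqv S X {#}" using eqv_norm[of S X] by simp
next
  assume X: "eqv S X {#}"
  have "norm_tree (absorbed S) t = {#}" if t: "t \<in># X" for t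
  proof -
    obtain Y where "X = {#t#} + Y" using multi_member_split[OF t] by auto
    then have "eqv S {#t#} {#}" using X eqv_cancel_empty by blast
    then show ?thesis by (intro norm_tree_absorbed) (simp add: absorbed_def)
  qed
  then show "norm_forest (absorbed S) X = {#}" by (simp add: norm_forest_def)
qed

lemma norm_consume_size:
  assumes "Node a N \<in># X" "Node a N \<notin> E"
  shows "msize (norm_forest E X) = Suc (msize (norm_forest E (X - {#Node a N#} + N)))"
  using assms by (auto dest!: multi_member_split simp: norm_tree_Node msize_prefix_nf)

text \<open>The tree normalises to k+1 copies of some \<open>Node a M\<close>, its children to
  \<open>M\<close> and k copies. So firing it amounts to firing any one of the copies in the normal
  form; with \<open>norm_nonempty\<close>, every move of the normal form lifts to
  \<open>X\<close>.\<close>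

lemma norm_consume_eq:
  assumes "Node a N \<in># X" "Node a N \<notin> E" "s \<in># norm_tree E (Node a N)"
  shows "label s = a \<and> s \<in># norm_forest E X \<and> norm_forest E (X - {#Node a N#} + N) = norm_forest E X - {#s#} + kids s"
proof -
  obtain Y where X: "X = add_mset (Node a N) Y" using assms(1) by (metis multi_member_split)
  obtain M k where M: "norm_forest E N = M + replicate_mset k (Node a M)"
    "prefix_nf a (norm_forest E N) = replicate_mset (Suc k) (Node a M)"
    by (rule prefix_nf_cases[of "norm_forest E N" a])
  have "norm_tree E (Node a N) = replicate_mset (Suc k) (Node a M)"
    using assms(2) M(2) by (simp add: norm_tree_Node)
  with assms(3) M(1) show ?thesis by (auto simp: X split: if_splits)
qed

text \<open>Absorbed roots contribute nothing, so firing one, like firing a replicated prefix, can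
  only add nodes; firing an unabsorbed root loses exactly one.\<close>

lemma norm_step_cases:
  assumes "step (S, X) a p"
  obtains N where "p = (S, X - {#Node a N#} + N)" "Node a N \<in># X" "Node a N \<notin> E"
    "msize (norm_forest E X) = Suc (msize (norm_forest E (X - {#Node a N#} + N)))"
  | X' where "p = (S, X')" "msize (norm_forest E X) \<le> msize (norm_forest E X')"
  using assms
proof (cases rule: step_cases)
  case (1 B)
  show thesis
  proof (cases "Node a B \<in> E")
    case True
    then have "msize (norm_forest E X) \<le> msize (norm_forest E (X - {#Node a B#} + B))"
      using 1(2) by (auto dest!: multi_member_split simp: norm_tree_absorbed)
    then show thesis by (rule that(2)[OF 1(1)])
  next
    case False
    show thesis by (rule that(1)[OF 1 False norm_consume_size[OF 1(2) False]])
  qed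
next
  case (2 B)
  then show thesis using that(2)[of "X + B"] by simp
qed

lemma norm_nonempty:
  assumes "s \<in># norm_forest E X"
  obtains a N where "Node a N \<in># X" "Node a N \<notin> E" "s \<in># norm_tree E (Node a N)"
proof -
  obtain t where t: "t \<in># X" "s \<in># norm_tree E t" using assms by (auto simp: norm_forest_def)
  obtain a N where "t = Node a N" by (cases t)
  with t that show thesis using norm_tree_absorbed[of t E] by force
qed

lemma msize_eq_0_iff: "msize M = 0 \<longleftrightarrow> M = {#}"
proof (cases M)
  case (add t M')
  then show ?thesis by (cases t) simp
qed simp

text \<open>Let \<open>X\<close> make a move that removes a node. The answer of \<open>Y\<close>
  loses at most one, so the bound for the successors carries back. The base case is a forest
  equivalent to the empty one, settled by \<open>norm_empty_iff\<close>.\<close>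

lemma eqv_msize_norm_le:
  "eqv S X Y \<Longrightarrow> msize (norm_forest (absorbed S) Y) \<le> msize (norm_forest (absorbed S) X)"
proof (induction "msize (norm_forest (absorbed S) X)" arbitrary: X Y)
  case 0
  let ?E = "absorbed S"
  have "norm_forest ?E X = {#}" using 0(1) msize_eq_0_iff[of "norm_forest ?E X"] by simp
  then have "eqv S X {#}" by (simp add: norm_empty_iff)
  with eqv_sym[OF 0(2)] have "eqv S Y {#}" by (rule eqv_trans)
  then have "norm_forest ?E Y = {#}" by (simp add: norm_empty_iff)
  then show ?case by simp
next
  case (Suc n)
  let ?E = "absorbed S"
  have "norm_forest ?E X \<noteq> {#}" using Suc(2) by auto
  then obtain s where "s \<in># norm_forest ?E X" by (meson multiset_nonemptyE)
  then obtain a N where N: "Node a N \<in># X" "Node a N \<notin> ?E" by (rule norm_nonempty)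
  define X' where "X' = X - {#Node a N#} + N"
  have X': "msize (norm_forest ?E X) = Suc (msize (norm_forest ?E X'))"
    unfolding X'_def using N by (rule norm_consume_size)
  have "step (S, X) a (S, X')" unfolding X'_def using N(1) by (rule step_Node)
  then obtain Y' where Y': "step (S, Y) a (S, Y')" "eqv S X' Y'"
    using eqv_stepD[OF Suc(3)] by blast
  have "msize (norm_forest ?E Y') \<le> msize (norm_forest ?E X')"
    using Suc(1)[OF _ Y'(2)] Suc(2) X' by simp
  moreover have "msize (norm_forest ?E Y) \<le> Suc (msize (norm_forest ?E Y'))"
    using Y'(1) by (cases rule: norm_step_cases[where E = ?E]) auto
  ultimately show ?case using X' by simp
qed

lemma eqv_msize_norm_eq: "eqv S X Y \<Longrightarrow> msize (norm_forest (absorbed S) X) = msize (norm_forest (absorbed S) Y)"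
  by (rule antisym) (erule eqv_msize_norm_le[OF eqv_sym], erule eqv_msize_norm_le)

lemma eqv_norm_eq: "eqv S X Y \<Longrightarrow> norm_forest (absorbed S) X = norm_forest (absorbed S) Y"
proof (induction "msize (norm_forest (absorbed S) X)" arbitrary: X Y rule: less_induct)
  case less
  let ?E = "absorbed S"
  \<comment> \<open>Needed from \<open>X\<close> to \<open>Y\<close> and from \<open>Y\<close> to
    \<open>X\<close>, hence stated for its own forests with the induction hypothesis as a
    premise.\<close>
  have match: "\<exists>s'\<in>#norm_forest ?E Y. label s' = label s \<and>
      norm_forest ?E X - {#s#} + kids s = norm_forest ?E Y - {#s'#} + kids s'"
    if s: "s \<in># norm_forest ?E X" and e: "eqv S X Y" and sz: "msize (norm_forest ?E X) = m"
      and IH: "\<And>X' Y'. eqv S X' Y' \<Longrightarrow> msize (norm_forest ?E X') < m \<Longrightarrow> norm_forest ?E X' = norm_forest ?E Y'"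
    for s X Y m
  proof -
    obtain a N where N: "Node a N \<in># X" "Node a N \<notin> ?E" "s \<in># norm_tree ?E (Node a N)"
      using s by (rule norm_nonempty)
    define X' where "X' = X - {#Node a N#} + N"
    have X': "label s = a" "norm_forest ?E X' = norm_forest ?E X - {#s#} + kids s"
      unfolding X'_def using norm_consume_eq[OF N] by auto
    have szX: "msize (norm_forest ?E X) = Suc (msize (norm_forest ?E X'))"
      unfolding X'_def using N(1,2) by (rule norm_consume_size)
    have "step (S, X) a (S, X')" unfolding X'_def using N(1) by (rule step_Node)
    then obtain Y' where Y': "step (S, Y) a (S, Y')" "eqv S X' Y'"
      using eqv_stepD[OF e] by blast
    have eq: "norm_forest ?E X' = norm_forest ?E Y'" using IH[OF Y'(2)] szX sz by simp
    from Y'(1) show ?thesis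
    proof (cases rule: norm_step_cases[where E = ?E])
      case (1 M)
      have "norm_tree ?E (Node a M) \<noteq> {#}"
        using 1(3) msize_prefix_nf[of a "norm_forest ?E M"] by (auto simp: norm_tree_Node)
      then obtain s' where s': "s' \<in># norm_tree ?E (Node a M)" by (meson multiset_nonemptyE)
      show ?thesis
        using norm_consume_eq[OF 1(2,3) s'] 1(1) eq X' by (intro bexI[of _ s']) auto
    next
      \<comment> \<open>Impossible: the sizes agree before and after the move, so the answer of
        \<open>Y\<close> has to lose a node as well.\<close>
      case 2
      then show ?thesis using szX eqv_msize_norm_eq[OF e] eq by simp
    qed
  qed
  have sz: "msize (norm_forest ?E X) = msize (norm_forest ?E Y)"
    using less(2) by (rule eqv_msize_norm_eq)
  show ?case
  proof (rule irreducible_multiset_eqI)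
    fix u assume "u \<in># norm_forest ?E X"
    from match[OF this less(2) refl] less(1)
    show "\<exists>s\<in>#norm_forest ?E Y. label s = label u \<and> norm_forest ?E X - {#u#} + kids u = norm_forest ?E Y - {#s#} + kids s"
      by blast
  next
    fix s assume "s \<in># norm_forest ?E Y"
    from match[OF this eqv_sym[OF less(2)] sz[symmetric]] less(1)
    obtain u where "u \<in># norm_forest ?E X" "label u = label s"
      "norm_forest ?E Y - {#s#} + kids s = norm_forest ?E X - {#u#} + kids u" by blast
    then show "\<exists>u\<in>#norm_forest ?E X. label s = label u \<and> norm_forest ?E X - {#u#} + kids u = norm_forest ?E Y - {#s#} + kids s"
      by (intro bexI[of _ u]) auto
  qed (rule norm_irreducible, assumption)+
qed

section \<open>Idempotent states and the comparison of different sets of replicated prefixes\<close>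

definition idempotent :: "'a state \<Rightarrow> bool" where
  "idempotent p \<longleftrightarrow> bis (fst p, snd p + snd p) p"

text \<open>\<open>(R, B + B)\<close> and \<open>(S, A + A)\<close> both arise from the mixed
  composition \<open>(S \<union> R, A + B)\<close> by replacing one factor with a bisimilar one.
  Only forests are doubled, since the union of a set with itself is that set.\<close>

lemma idempotent_bis:
  assumes "bis (S, A) (R, B)" "idempotent (S, A)"
  shows "idempotent (R, B)"
proof -
  have "bis (R, B + B) (S \<union> R, A + B)"
    using bis_par[OF bis_sym[OF assms(1)], of R B] by simp
  also have "bis (S \<union> R, A + B) (S, A + A)"
    using bis_par[OF bis_sym[OF assms(1)], of S A] by (simp add: Un_commute union_commute)
  also have "bis (S, A + A) (S, A)" using assms(2) by (simp add: idempotent_def)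
  also have "bis (S, A) (R, B)" by (rule assms(1))
  finally show ?thesis by (simp add: idempotent_def)
qed

text \<open>\<open>A + A\<close> and \<open>A\<close> then have equal normal forms, and a finite
  multiset equal to its own double is empty.\<close>

lemma idempotent_iff: "idempotent (S, A) \<longleftrightarrow> norm_forest (absorbed S) A = {#}"
proof
  assume "idempotent (S, A)"
  then have "eqv S (A + A) A" by (simp add: idempotent_def eqv_def)
  from eqv_norm_eq[OF this] show "norm_forest (absorbed S) A = {#}" by simp
next
  assume "norm_forest (absorbed S) A = {#}"
  then have "eqv S A {#}" by (simp add: norm_empty_iff)
  from eqv_add_right[OF this, of A] show "idempotent (S, A)" by (simp add: idempotent_def eqv_def)
qed

lemma bis_strip:
  "bis (S, A) (R, B) \<Longrightarrow> bis (S, {#}) (R, {#})"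
proof (induction "msize (norm_forest (absorbed S) A)" arbitrary: A B)
  case 0
  have A: "norm_forest (absorbed S) A = {#}" using 0(1) msize_eq_0_iff[of "norm_forest (absorbed S) A"] by simp
  then have "idempotent (R, B)" using idempotent_bis[OF 0(2)] by (simp add: idempotent_iff)
  then have "norm_forest (absorbed R) B = {#}" by (simp add: idempotent_iff)
  with A have "bis (S, A) (S, {#})" "bis (R, B) (R, {#})" by (simp_all add: norm_empty_iff eqv_def)
  from bis_trans[OF bis_sym[OF this(1)] bis_trans[OF 0(2) this(2)]] show ?case .
next
  case (Suc n)
  let ?E = "absorbed S"
  have "norm_forest ?E A \<noteq> {#}" using Suc(2) by auto
  then obtain s where "s \<in># norm_forest ?E A" by (meson multiset_nonemptyE)
  then obtain a N where N: "Node a N \<in># A" "Node a N \<notin> ?E" by (rule norm_nonempty)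
  obtain B' where "bis (S, A - {#Node a N#} + N) (R, B')"
    using bis_step_obtain[OF Suc(3) step_Node[OF N(1)]] by blast
  moreover have "n = msize (norm_forest ?E (A - {#Node a N#} + N))"
    using norm_consume_size[OF N] Suc(2) by simp
  ultimately show ?case using Suc(1) by blast
qed

lemma bis_absorbed: assumes "bis (S, {#}) (R, {#})" shows "absorbed S \<subseteq> absorbed R"
proof
  fix t assume "t \<in> absorbed S"
  then have "bis (S, {#t#}) (S, {#})" by (simp add: absorbed_def eqv_def)
  moreover have "bis (R, {#t#}) (S, {#t#})"
    using bis_par[OF bis_sym[OF assms], of "{}" "{#t#}"] by simp
  ultimately have "bis (R, {#t#}) (R, {#})" using assms bis_trans by blast
  then show "t \<in> absorbed R" by (simp add: absorbed_def eqv_def)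
qed

definition norm_bangs :: "('a \<times> 'a tree multiset) set \<Rightarrow> ('a \<times> 'a tree multiset) set" where
  "norm_bangs S = apsnd (norm_forest (absorbed S)) ` S"

text \<open>With an empty forest, \<open>R\<close> can answer a replicated prefix of
  \<open>S\<close> only by one of its own. Replacing \<open>S\<close> by \<open>R\<close> under
  \<open>N\<close> makes the two continuations comparable over \<open>R\<close>, where
  \<open>eqv_norm_eq\<close> applies.\<close>

lemma norm_bangs_subset:
  assumes "bis (S, {#}) (R, {#})" "absorbed S = absorbed R"
  shows "norm_bangs S \<subseteq> norm_bangs R"
proof -
  have "(a, norm_forest (absorbed S) N) \<in> norm_bangs R" if "(a, N) \<in> S" for a N
  proof -
    have "step (S, {#}) a (S, N)" using step_Bang[OF that, of "{#}"] by simp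
    then obtain M where M: "step (R, {#}) a (R, M)" "bis (S, N) (R, M)"
      using bis_step_obtain[OF assms(1)] by blast
    have "(a, M) \<in> R" using M(1) by (auto simp: step_def)
    moreover have "norm_forest (absorbed S) N = norm_forest (absorbed R) M"
    proof -
      have "bis (R, N) (S, N)" using bis_par[OF bis_sym[OF assms(1)], of "{}" N] by simp
      then have "eqv R N M" using M(2) unfolding eqv_def by (rule bis_trans)
      then show ?thesis using eqv_norm_eq[of R N M] assms(2) by simp
    qed
    ultimately show ?thesis by (force simp: norm_bangs_def)
  qed
  then show ?thesis by (auto simp: norm_bangs_def)
qed

theorem bis_norm:
  assumes "bis (S, A) (R, B)"
  shows "absorbed S = absorbed R" "norm_bangs S = norm_bangs R"
    "norm_forest (absorbed S) A = norm_forest (absorbed R) B"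
proof -
  have SR: "bis (S, {#}) (R, {#})" using bis_strip[OF assms] .
  note RS = bis_sym[OF SR]
  show E: "absorbed S = absorbed R" using bis_absorbed[OF SR] bis_absorbed[OF RS] by blast
  show "norm_bangs S = norm_bangs R"
    using norm_bangs_subset[OF SR E] norm_bangs_subset[OF RS E[symmetric]] by blast
  have "bis (R, B) (S, B)" using bis_par[OF RS, of "{}" B] by simp
  with assms have "eqv S A B" unfolding eqv_def by (rule bis_trans)
  then show "norm_forest (absorbed S) A = norm_forest (absorbed R) B" using E eqv_norm_eq[of S A B] by simp
qed

text \<open>The empty forest answers the absorbed tree through some replicated \<open>(a, M)\<close>
  with \<open>M\<close> equivalent to \<open>N\<close> over \<open>S\<close>. Equality of the normal
  forms supplies the literal match that \<open>B1\<close> needs.\<close>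

lemma absorbed_Node_norm_bangs:
  assumes "Node a N \<in> absorbed S"
  shows "(a, norm_forest (absorbed S) N) \<in> norm_bangs S"
proof -
  have "eqv S {#Node a N#} {#}" using assms by (simp add: absorbed_def)
  moreover have "step (S, {#Node a N#}) a (S, N)" using step_Node[of a N "{#Node a N#}" S] by simp
  ultimately obtain M where M: "step (S, {#}) a (S, M)" "eqv S N M" by (rule eqv_stepD)
  have "(a, M) \<in> S" using M(1) by (auto simp: step_def)
  with eqv_norm_eq[OF M(2)] show ?thesis by (force simp: norm_bangs_def)
qed

subsection \<open>Processes as states\<close>

lemma finite_process_simps [simp]:
  "finite_process Null"
  "finite_process (Pre a F) \<longleftrightarrow> finite_process F"
  "\<not> finite_process (Bang a F)"
  "finite_process (F \<parallel> G) \<longleftrightarrow> finite_process F \<and> finite_process G"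
  by (auto intro: finite_process.intros elim: finite_process.cases)

lemma process_simps [simp]:
  "process Null"
  "process (Pre a F) \<longleftrightarrow> finite_process F"
  "process (Bang a F) \<longleftrightarrow> finite_process F"
  "process (P \<parallel> Q) \<longleftrightarrow> process P \<and> process Q"
proof -
  show "process (P \<parallel> Q) \<longleftrightarrow> process P \<and> process Q"
  proof
    assume "process (P \<parallel> Q)"
    then show "process P \<and> process Q" by cases (auto intro: process.intros)
  qed (auto intro: process.intros)
qed (auto intro: process.intros elim: process.cases)

primrec forest :: "'a raw \<Rightarrow> 'a tree multiset" where
  "forest Null = {#}"
| "forest (Pre a F) = {#Node a (forest F)#}"
| "forest (Bang a F) = {#}"
| "forest (P \<parallel> Q) = forest P + forest Q"

primrec bangs :: "'a raw \<Rightarrow> ('a \<times> 'a tree multiset) set" where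
  "bangs Null = {}"
| "bangs (Pre a F) = {}"
| "bangs (Bang a F) = {(a, forest F)}"
| "bangs (P \<parallel> Q) = bangs P \<union> bangs Q"

lemma bangs_finite_process: "finite_process F \<Longrightarrow> bangs F = {}"
  by (induction rule: finite_process.induct) auto

lemma finite_bangs: "finite (bangs P)"
  by (induction P) auto

text \<open>Continuations are finite and contain no replication, whence \<open>bangs\<close> is
  constant.\<close>

lemma transition_step:
  "transition P a P' \<Longrightarrow> process P \<Longrightarrow>
    process P' \<and> bangs P' = bangs P \<and> step (bangs P, forest P) a (bangs P, forest P')"
proof (induction rule: transition.induct)
  case (pre F a)
  then show ?case using step_Node[of a "forest F" "{#Node a (forest F)#}"]
    by (simp add: bangs_finite_process process.intros)
next
  case (bang F a)
  then show ?case using step_Bang[of a "forest F" "{(a, forest F)}" "{#}"]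
    by (simp add: bangs_finite_process process.intros)
next
  case (par_left P a P' Q)
  then show ?case by (simp add: step_par_left)
next
  case (par_right P a P' Q)
  then show ?case by (simp add: step_par_right)
qed

lemma step_transition:
  "process P \<Longrightarrow> step (bangs P, forest P) a (bangs P, A) \<Longrightarrow> \<exists>P'. transition P a P' \<and> forest P' = A"
proof (induction P arbitrary: A)
  case Null
  then show ?case by (simp add: step_def)
next
  case (Pre b F)
  then show ?case using transition.pre[of F b] by (auto simp: step_Node_iff)
next
  case (Bang b F)
  then show ?case using transition.bang[of F b] by (auto simp: step_def intro!: exI[of _ "Bang b F \<parallel> F"])
next
  case (Par P Q)
  have "step (bangs P \<union> bangs Q, forest P + forest Q) a (bangs P \<union> bangs Q, A)"
    using Par(4) by simp
  then show ?case
  proof (cases rule: step_par_cases)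
    case (1 A')
    then obtain P' where "transition P a P'" "forest P' = A'" using Par by auto
    then show ?thesis using 1 Par(3) transition.par_left[of P a P' Q] by (intro exI[of _ "P' \<parallel> Q"]) simp
  next
    case (2 C')
    then obtain Q' where "transition Q a Q'" "forest Q' = C'" using Par by auto
    then show ?thesis using 2 Par(3) transition.par_right[of Q a Q' P] by (intro exI[of _ "P \<parallel> Q'"]) simp
  qed
qed

lemma bisimilar_sym:
  fixes P Q :: "'a raw"
  assumes "P \<sim> Q"
  shows "Q \<sim> P"
proof -
  have "bisimulation ((\<sim>) :: 'a raw \<Rightarrow> _)" by (rule bisimulation_bisimilar)
  then have "symp ((\<sim>) :: 'a raw \<Rightarrow> _)" by (simp add: bisimulation_def)
  then show ?thesis using assms by (rule sympD)
qed

lemma bisimilar_process: "P \<sim> Q \<Longrightarrow> process P \<and> process Q"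
  by (auto simp: bisimilar_def bisimulation_def)

lemma bisimilar_transition:
  fixes P Q :: "'a raw"
  assumes "P \<sim> Q" "transition P a P'"
  shows "\<exists>Q'. transition Q a Q' \<and> P' \<sim> Q'"
proof -
  have "bisimulation ((\<sim>) :: 'a raw \<Rightarrow> _)" by (rule bisimulation_bisimilar)
  then have "\<forall>(P :: 'a raw) Q a P'. P \<sim> Q \<longrightarrow> transition P a P' \<longrightarrow> (\<exists>Q'. transition Q a Q' \<and> P' \<sim> Q')"
    unfolding bisimulation_def by (elim conjE)
  then show ?thesis using assms by blast
qed

lemma bisimilar_step:
  assumes "P \<sim> Q" "step (bangs P, forest P) a p'"
  shows "\<exists>P' Q'. p' = (bangs P', forest P') \<and> step (bangs Q, forest Q) a (bangs Q', forest Q') \<and> P' \<sim> Q'"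
proof -
  have "process P" "process Q"
    using bisimilar_process[OF assms(1)] by simp_all
  obtain A where A: "p' = (bangs P, A)" using step_fst[OF assms(2)] by (cases p') auto
  then obtain P' where P': "transition P a P'" "forest P' = A"
    using step_transition[OF \<open>process P\<close>, of a A] assms(2) by auto
  obtain Q' where Q': "transition Q a Q'" "P' \<sim> Q'"
    using bisimilar_transition[OF assms(1) P'(1)] by blast
  show ?thesis
    using transition_step[OF P'(1) \<open>process P\<close>] transition_step[OF Q'(1) \<open>process Q\<close>] A P'(2) Q'(2)
    by (intro exI[of _ P'] exI[of _ Q']) simp
qed

lemma bisimilar_iff_bis:
  assumes "process P" "process Q"
  shows "P \<sim> Q \<longleftrightarrow> bis (bangs P, forest P) (bangs Q, forest Q)"
proof
  define R where "R = (\<lambda>p q. \<exists>P Q :: 'a raw. p = (bangs P, forest P) \<and> q = (bangs Q, forest Q) \<and> P \<sim> Q)"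
  have R_I: "R (bangs P, forest P) (bangs Q, forest Q)" if "P \<sim> Q" for P Q
    unfolding R_def by (rule exI conjI refl that)+
  assume "P \<sim> Q"
  then have "R (bangs P, forest P) (bangs Q, forest Q)" by (rule R_I)
  then show "bis (bangs P, forest P) (bangs Q, forest Q)"
  proof (rule bis_coinductI)
    fix p q a p'
    assume "R p q" and st: "step p a p'"
    then obtain P Q where PQ: "p = (bangs P, forest P)" "q = (bangs Q, forest Q)" "P \<sim> Q"
      unfolding R_def by (elim exE conjE)
    obtain P' Q' where "p' = (bangs P', forest P')" "step q a (bangs Q', forest Q')" "P' \<sim> Q'"
      using bisimilar_step[OF PQ(3) st[unfolded PQ(1)]] unfolding PQ(2) by (elim exE conjE)
    with R_I[of P' Q'] show "\<exists>q'. step q a q' \<and> R p' q'"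
      by (intro exI[of _ "(bangs Q', forest Q')"]) simp
  next
    fix p q a q'
    assume "R p q" and st: "step q a q'"
    then obtain P Q where PQ: "p = (bangs P, forest P)" "q = (bangs Q, forest Q)" "P \<sim> Q"
      unfolding R_def by (elim exE conjE)
    obtain P' Q' where "q' = (bangs Q', forest Q')" "step p a (bangs P', forest P')" "Q' \<sim> P'"
      using bisimilar_step[OF bisimilar_sym[OF PQ(3)] st[unfolded PQ(2)]] unfolding PQ(1) by (elim exE conjE)
    with R_I[OF bisimilar_sym, of Q' P'] show "\<exists>p'. step p a p' \<and> R p' q'"
      by (intro exI[of _ "(bangs P', forest P')"]) simp
  qed
next
  assume b: "bis (bangs P, forest P) (bangs Q, forest Q)"
  define R where "R = (\<lambda>P Q :: 'a raw. process P \<and> process Q \<and> bis (bangs P, forest P) (bangs Q, forest Q))"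
  have "bisimulation R"
    unfolding bisimulation_def
  proof (intro conjI allI impI)
    show "symp R" by (rule sympI) (simp add: R_def bis_sym)
  next
    fix P Q a P'
    assume "R P Q" and t: "transition P a P'"
    then have PQ: "process P" "process Q" and b: "bis (bangs P, forest P) (bangs Q, forest Q)"
      by (simp_all add: R_def)
    have P': "process P'" "bangs P' = bangs P" "step (bangs P, forest P) a (bangs P, forest P')"
      using transition_step[OF t PQ(1)] by simp_all
    obtain B' where B': "step (bangs Q, forest Q) a (bangs Q, B')" "bis (bangs P, forest P') (bangs Q, B')"
      by (rule bis_step_obtain[OF b P'(3)])
    obtain Q' where Q': "transition Q a Q'" "forest Q' = B'"
      using step_transition[OF PQ(2) B'(1)] by (elim exE conjE)
    have "R P' Q'"
      using P' B'(2) transition_step[OF Q'(1) PQ(2)] Q'(2) by (simp add: R_def)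
    then show "\<exists>Q'. transition Q a Q' \<and> R P' Q'" using Q'(1) by blast
  qed (simp_all add: R_def)
  moreover have "R P Q" using b assms by (simp add: R_def)
  ultimately show "P \<sim> Q" unfolding bisimilar_def by (intro exI[of _ R] conjI)
qed

subsection \<open>Convertible processes are bisimilar\<close>

text \<open>The set \<open>N\<close> is meant to be that of a fixed target, not of P or Q:
  \<open>B1\<close> also acts below a replication and so changes \<open>bangs\<close>, and it erases
  prefixes that the rewritten process itself need not absorb.\<close>

definition agree :: "('a \<times> 'a tree multiset) set \<Rightarrow> 'a raw \<Rightarrow> 'a raw \<Rightarrow> bool" where
  "agree N P Q \<longleftrightarrow> eqv N (forest P) (forest Q) \<and>
     (\<forall>(a, X)\<in>bangs P. \<exists>Y. (a, Y) \<in> bangs Q \<and> eqv N X Y) \<and>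
     (\<forall>(a, Y)\<in>bangs Q. \<exists>X. (a, X) \<in> bangs P \<and> eqv N X Y)"

lemma agree_refl [simp]: "agree N P P"
  by (auto simp: agree_def)

lemma agreeI:
  assumes "eqv N (forest P) (forest Q)"
    and "\<And>a X. (a, X) \<in> bangs P \<Longrightarrow> \<exists>Y. (a, Y) \<in> bangs Q \<and> eqv N X Y"
    and "\<And>a Y. (a, Y) \<in> bangs Q \<Longrightarrow> \<exists>X. (a, X) \<in> bangs P \<and> eqv N X Y"
  shows "agree N P Q"
  using assms by (auto simp: agree_def)

lemma agreeD:
  assumes "agree N P Q"
  shows "eqv N (forest P) (forest Q)"
    and "\<And>a X. (a, X) \<in> bangs P \<Longrightarrow> \<exists>Y. (a, Y) \<in> bangs Q \<and> eqv N X Y"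
    and "\<And>a Y. (a, Y) \<in> bangs Q \<Longrightarrow> \<exists>X. (a, X) \<in> bangs P \<and> eqv N X Y"
  using assms by (auto simp: agree_def)

lemma agree_sym:
  assumes "agree N P Q"
  shows "agree N Q P"
proof (rule agreeI)
  show "eqv N (forest Q) (forest P)" using agreeD(1)[OF assms] by (rule eqv_sym)
  show "\<exists>Y. (a, Y) \<in> bangs P \<and> eqv N X Y" if "(a, X) \<in> bangs Q" for a X
    using agreeD(3)[OF assms that] eqv_sym[of N _ X] by metis
  show "\<exists>X. (a, X) \<in> bangs Q \<and> eqv N X Y" if "(a, Y) \<in> bangs P" for a Y
    using agreeD(2)[OF assms that] eqv_sym[of N Y] by metis
qed

lemma agree_trans:
  assumes "agree N P Q" "agree N Q R"
  shows "agree N P R"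
proof (rule agreeI)
  show "eqv N (forest P) (forest R)"
    using agreeD(1)[OF assms(1)] agreeD(1)[OF assms(2)] by (rule eqv_trans)
next
  fix a X assume "(a, X) \<in> bangs P"
  then obtain Y where Y: "(a, Y) \<in> bangs Q" "eqv N X Y" using agreeD(2)[OF assms(1)] by blast
  then obtain Z where "(a, Z) \<in> bangs R" "eqv N Y Z" using agreeD(2)[OF assms(2)] by blast
  then show "\<exists>Y. (a, Y) \<in> bangs R \<and> eqv N X Y" using eqv_trans[OF Y(2)] by blast
next
  fix a Z assume "(a, Z) \<in> bangs R"
  then obtain Y where Y: "(a, Y) \<in> bangs Q" "eqv N Y Z" using agreeD(3)[OF assms(2)] by blast
  then obtain X where "(a, X) \<in> bangs P" "eqv N X Y" using agreeD(3)[OF assms(1)] by blast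
  then show "\<exists>X. (a, X) \<in> bangs P \<and> eqv N X Z" using eqv_trans[OF _ Y(2)] by blast
qed

lemma agree_par:
  assumes "agree N P P'" "agree N Q Q'"
  shows "agree N (P \<parallel> Q) (P' \<parallel> Q')"
proof (rule agreeI)
  show "eqv N (forest (P \<parallel> Q)) (forest (P' \<parallel> Q'))"
    using agreeD(1)[OF assms(1)] agreeD(1)[OF assms(2)] by (simp add: eqv_add)
  show "\<exists>Y. (a, Y) \<in> bangs (P' \<parallel> Q') \<and> eqv N X Y" if "(a, X) \<in> bangs (P \<parallel> Q)" for a X
    using that agreeD(2)[OF assms(1), of a X] agreeD(2)[OF assms(2), of a X] by auto
  show "\<exists>X. (a, X) \<in> bangs (P \<parallel> Q) \<and> eqv N X Y" if "(a, Y) \<in> bangs (P' \<parallel> Q')" for a Y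
    using that agreeD(3)[OF assms(1), of a Y] agreeD(3)[OF assms(2), of a Y] by auto
qed

lemma agree_same_bangs: "bangs P = bangs Q \<Longrightarrow> eqv N (forest P) (forest Q) \<Longrightarrow> agree N P Q"
  by (auto simp: agree_def)

lemma agree_pre: "eqv N (forest F) (forest G) \<Longrightarrow> agree N (Pre a F) (Pre a G)"
  by (simp add: agree_def eqv_Node)

lemma agree_bang: "eqv N (forest F) (forest G) \<Longrightarrow> agree N (Bang a F) (Bang a G)"
  by (simp add: agree_def)

lemma agree_fill: "agree N F G \<Longrightarrow> agree N (fill C F) (fill C G)"
  by (induction C) (auto intro: agree_pre agree_bang agree_par agreeD(1))

lemma forest_par_copies: "forest (par_copies P (Pre a F) k) = forest P + replicate_mset k (Node a (forest F))"
  by (induction k) auto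

lemma bangs_par_copies: "bangs (par_copies P (Pre a F) k) = bangs P"
  by (induction k) auto

lemma agree_equivD: "P \<equiv>\<^sub>D Q \<Longrightarrow> agree N P Q"
proof (induction rule: equivD.induct)
  case (equiv_sym P Q)
  then show ?case by (simp add: agree_sym)
next
  case (equiv_trans P Q R)
  then show ?case by (blast intro: agree_trans)
next
  case (cong_par P P' Q Q')
  then show ?case by (simp add: agree_par)
next
  case (distrib F a k)
  then show ?case
    using eqv_distrib[of N a "forest F" k]
    by (intro agree_same_bangs) (simp_all add: forest_par_copies bangs_par_copies)
qed (simp_all add: agree_pre agree_bang agreeD(1) agree_same_bangs ac_simps)

text \<open>For \<open>B1\<close>, T replicates a prefix whose continuation is equivalent to that of
  the erased one, so the latter is absorbed over \<open>bangs T\<close>. \<open>B2\<close> is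
  invisible because \<open>bangs\<close> is a set.\<close>

lemma agree_rewrite_step:
  "rewrite_step T P Q \<Longrightarrow> agree (bangs T) P Q"
proof (induction rule: rewrite_step.induct)
  case (B1 C F F' a)
  let ?N = "bangs T"
  have "agree ?N T (Bang a F \<parallel> F')" using B1(4) by (rule agree_equivD)
  then obtain X where X: "(a, X) \<in> ?N" "eqv ?N X (forest F)" unfolding agree_def by auto
  have "eqv ?N {#Node a (forest F)#} {#Node a X#}" using eqv_Node[OF eqv_sym[OF X(2)]] .
  also have "eqv ?N {#Node a X#} {#}" using X(1) by (rule eqv_absorb)
  finally show ?case by (intro agree_fill agree_same_bangs) simp_all
next
  case (B2 F P a)
  then show ?case by (intro agree_same_bangs) simp_all
next
  case (mod_equivD P P' Q' Q)
  show ?case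
    using agree_trans[OF agree_equivD[OF mod_equivD(1)] agree_trans[OF mod_equivD(4) agree_equivD[OF mod_equivD(3)]]] .
qed

lemma agree_rewrite_star: "rewrite_star T P Q \<Longrightarrow> agree (bangs T) P Q"
  unfolding rewrite_star_def
proof (induction rule: rtranclp_induct)
  case (step Q R)
  then have "agree (bangs T) Q R" using agree_equivD agree_rewrite_step by blast
  with step.IH show ?case by (rule agree_trans)
qed simp

text \<open>Since the chain ends in T, the set over which its steps agree is the set of the last
  process itself, and \<open>bis_rel_set\<close> turns agreement into bisimilarity.\<close>

lemma bis_of_rewrite_star:
  assumes "rewrite_star T P T"
  shows "bis (bangs P, forest P) (bangs T, forest T)"
proof -
  have a: "agree (bangs T) P T" using assms by (rule agree_rewrite_star)
  then have "bis (bangs P, forest P) (bangs T, forest P)"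
    by (intro bis_rel_set) (use agreeD(2,3)[OF a] in blast)+
  also have "bis (bangs T, forest P) (bangs T, forest T)"
    using agreeD(1)[OF a] by (simp add: eqv_def)
  finally show ?thesis .
qed

subsection \<open>Rewriting to the normal form\<close>

lemma equivD_process: "P \<equiv>\<^sub>D Q \<Longrightarrow> process P \<and> process Q \<and> (finite_process P \<longleftrightarrow> finite_process Q)"
proof (induction rule: equivD.induct)
  case (distrib F a k)
  have "finite_process (par_copies G (Pre a F) k)" if "finite_process G" for G
    using that distrib by (induction k) simp_all
  then show ?case using distrib by (simp add: process.intros)
qed (auto intro: process.intros)

declare equiv_trans [trans]

section \<open>Monoid laws for compositions of lists and multisets\<close>

lemma equivD_left_commute:
  assumes "process P" "process Q" "process R"
  shows "P \<parallel> (Q \<parallel> R) \<equiv>\<^sub>D Q \<parallel> (P \<parallel> R)"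
proof -
  have "P \<parallel> (Q \<parallel> R) \<equiv>\<^sub>D (P \<parallel> Q) \<parallel> R"
    using assms by (intro equiv_sym[OF assoc])
  also have "(P \<parallel> Q) \<parallel> R \<equiv>\<^sub>D (Q \<parallel> P) \<parallel> R"
    using assms by (intro cong_par comm equiv_refl)
  also have "(Q \<parallel> P) \<parallel> R \<equiv>\<^sub>D Q \<parallel> (P \<parallel> R)"
    using assms by (intro assoc)
  finally show ?thesis .
qed

lemma equivD_interchange:
  assumes "process P" "process Q" "process R" "process S"
  shows "(P \<parallel> Q) \<parallel> (R \<parallel> S) \<equiv>\<^sub>D (P \<parallel> R) \<parallel> (Q \<parallel> S)"
proof -
  have "(P \<parallel> Q) \<parallel> (R \<parallel> S) \<equiv>\<^sub>D P \<parallel> (Q \<parallel> (R \<parallel> S))"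
    using assms by (intro assoc) simp_all
  also have "P \<parallel> (Q \<parallel> (R \<parallel> S)) \<equiv>\<^sub>D P \<parallel> (R \<parallel> (Q \<parallel> S))"
    using assms by (intro cong_par equiv_refl equivD_left_commute)
  also have "P \<parallel> (R \<parallel> (Q \<parallel> S)) \<equiv>\<^sub>D (P \<parallel> R) \<parallel> (Q \<parallel> S)"
    using assms by (intro equiv_sym[OF assoc]) simp_all
  finally show ?thesis .
qed

lemma equivD_neutral_left:
  assumes "process P"
  shows "Null \<parallel> P \<equiv>\<^sub>D P"
  using equiv_trans[OF comm neutral] assms by simp

definition par_list :: "'a raw list \<Rightarrow> 'a raw" where
  "par_list Ps = foldr (\<parallel>) Ps Null"

lemma par_list_simps [simp]:
  "par_list [] = Null"
  "par_list (P # Ps) = P \<parallel> par_list Ps"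
  by (simp_all add: par_list_def)

lemma process_par_list [simp]: "process (par_list Ps) \<longleftrightarrow> (\<forall>P\<in>set Ps. process P)"
  by (induction Ps) simp_all

lemma finite_process_par_list [simp]: "finite_process (par_list Ps) \<longleftrightarrow> (\<forall>P\<in>set Ps. finite_process P)"
  by (induction Ps) simp_all

lemma par_list_append:
  assumes "\<forall>P\<in>set (Ps @ Qs). process P"
  shows "par_list (Ps @ Qs) \<equiv>\<^sub>D par_list Ps \<parallel> par_list Qs"
  using assms
proof (induction Ps)
  case Nil
  then show ?case by (simp add: equiv_sym[OF equivD_neutral_left])
next
  case (Cons P Ps)
  have "P \<parallel> par_list (Ps @ Qs) \<equiv>\<^sub>D P \<parallel> (par_list Ps \<parallel> par_list Qs)"
    using Cons by (intro cong_par equiv_refl) simp_all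
  also have "P \<parallel> (par_list Ps \<parallel> par_list Qs) \<equiv>\<^sub>D (P \<parallel> par_list Ps) \<parallel> par_list Qs"
    using Cons(2) by (intro equiv_sym[OF assoc]) simp_all
  finally show ?case by simp
qed

lemma par_list_perm:
  "mset Ps = mset Qs \<Longrightarrow> \<forall>P\<in>set Ps. process P \<Longrightarrow> par_list Ps \<equiv>\<^sub>D par_list Qs"
proof (induction Ps arbitrary: Qs)
  case Nil
  then show ?case by (simp add: equiv_refl)
next
  case (Cons P Ps)
  have "P \<in> set Qs" using Cons(2) by (metis list.set_intros(1) set_mset_mset)
  then obtain Us Vs where Qs: "Qs = Us @ P # Vs" by (meson split_list)
  have set: "set (P # Ps) = set Qs" using Cons(2) by (metis set_mset_mset)
  have p: "\<forall>Q\<in>set (Us @ P # Vs). process Q" using Cons(3) unfolding set Qs .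
  have "mset Ps = mset (Us @ Vs)" using Cons(2) Qs by simp
  then have "par_list Ps \<equiv>\<^sub>D par_list (Us @ Vs)" using Cons(1,3) by simp
  also have "par_list (Us @ Vs) \<equiv>\<^sub>D par_list Us \<parallel> par_list Vs"
    using p by (intro par_list_append) auto
  finally have "P \<parallel> par_list Ps \<equiv>\<^sub>D P \<parallel> (par_list Us \<parallel> par_list Vs)"
    using p by (intro cong_par equiv_refl) auto
  also have "P \<parallel> (par_list Us \<parallel> par_list Vs) \<equiv>\<^sub>D par_list Us \<parallel> (P \<parallel> par_list Vs)"
    using p by (intro equivD_left_commute) auto
  also have "par_list Us \<parallel> (P \<parallel> par_list Vs) \<equiv>\<^sub>D par_list Qs"
    using equiv_sym[OF par_list_append[OF p]] by (simp add: Qs)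
  finally show ?case by simp
qed

text \<open>The order is arbitrary but determined by the multiset, so equal multisets give the same
  term; \<open>par_list_perm\<close> makes the choice irrelevant up to
  \<open>\<equiv>\<^sub>D\<close>.\<close>

definition par_mset :: "'a raw multiset \<Rightarrow> 'a raw" where
  "par_mset M = par_list (SOME Ps. mset Ps = M)"

lemma par_mset_eq:
  obtains Ps where "mset Ps = M" "par_mset M = par_list Ps"
  using someI_ex[OF ex_mset[of M]] that unfolding par_mset_def by blast

lemma process_par_mset [simp]: "process (par_mset M) \<longleftrightarrow> (\<forall>P\<in>#M. process P)"
  by (rule par_mset_eq[of M]) auto

lemma finite_process_par_mset [simp]: "finite_process (par_mset M) \<longleftrightarrow> (\<forall>P\<in>#M. finite_process P)"
  by (rule par_mset_eq[of M]) auto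

lemma par_mset_empty [simp]: "par_mset {#} = Null"
  by (rule par_mset_eq[of "{#}"]) simp

lemma par_mset_union:
  assumes "\<forall>P\<in>#M + N. process P"
  shows "par_mset (M + N) \<equiv>\<^sub>D par_mset M \<parallel> par_mset N"
proof -
  obtain Ps Qs Rs where eqs: "mset Ps = M" "mset Qs = N" "mset Rs = M + N"
    "par_mset M = par_list Ps" "par_mset N = par_list Qs" "par_mset (M + N) = par_list Rs"
    using par_mset_eq by metis
  have "\<forall>P\<in>set Rs. process P" using assms eqs(3) by (metis set_mset_mset)
  moreover have "\<forall>P\<in>set (Ps @ Qs). process P" using assms eqs(1,2) by auto
  ultimately show ?thesis
    using equiv_trans[OF par_list_perm[of Rs "Ps @ Qs"] par_list_append[of Ps Qs]] eqs by simp
qed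

lemma par_mset_single:
  assumes "process P"
  shows "par_mset {#P#} \<equiv>\<^sub>D P"
proof -
  obtain Ps where "mset Ps = {#P#}" "par_mset {#P#} = par_list Ps" by (rule par_mset_eq)
  then show ?thesis using assms by (simp add: neutral)
qed

lemma par_mset_add:
  assumes "process P" "\<forall>P\<in>#M. process P"
  shows "par_mset (add_mset P M) \<equiv>\<^sub>D P \<parallel> par_mset M"
proof -
  have "par_mset (add_mset P M) \<equiv>\<^sub>D par_mset {#P#} \<parallel> par_mset M"
    using par_mset_union[of "{#P#}" M] assms by simp
  also have "par_mset {#P#} \<parallel> par_mset M \<equiv>\<^sub>D P \<parallel> par_mset M"
    using assms by (intro cong_par par_mset_single equiv_refl) simp_all
  finally show ?thesis .
qed

section \<open>Trees and forests as finite processes\<close>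

primrec tree_process :: "'a tree \<Rightarrow> 'a raw" where
  "tree_process (Node a N) = Pre a (par_mset (image_mset tree_process N))"

definition forest_process :: "'a tree multiset \<Rightarrow> 'a raw" where
  "forest_process M = par_mset (image_mset tree_process M)"

lemma tree_process_Node: "tree_process (Node a N) = Pre a (forest_process N)"
  by (simp add: forest_process_def)

declare tree_process.simps [simp del]

lemma finite_process_tree_process [simp]: "finite_process (tree_process t)"
  by (induction t) (simp add: tree_process.simps)

lemma process_of_finite: "finite_process F \<Longrightarrow> process F"
  by (rule process.intros)

lemma finite_process_forest_process [simp]: "finite_process (forest_process M)"
  by (simp add: forest_process_def)

lemma process_forest_process [simp]: "process (forest_process M)" "process (tree_process t)"
  by (simp_all add: process_of_finite)

lemma forest_process_empty [simp]: "forest_process {#} = Null"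
  by (simp add: forest_process_def)

lemma forest_process_union: "forest_process (M + N) \<equiv>\<^sub>D forest_process M \<parallel> forest_process N"
  unfolding forest_process_def image_mset_union by (rule par_mset_union) auto

lemma forest_process_single: "forest_process {#t#} \<equiv>\<^sub>D tree_process t"
  unfolding forest_process_def using par_mset_single[of "tree_process t"] by simp

lemma forest_process_add: "forest_process (add_mset t M) \<equiv>\<^sub>D tree_process t \<parallel> forest_process M"
  unfolding forest_process_def image_mset_add_mset by (rule par_mset_add) auto

lemma equivD_forest_process: "finite_process F \<Longrightarrow> F \<equiv>\<^sub>D forest_process (forest F)"
proof (induction rule: finite_process.induct)
  case 1
  then show ?case by (simp add: equiv_refl)
next
  case (2 F a)
  then have "Pre a F \<equiv>\<^sub>D tree_process (Node a (forest F))" unfolding tree_process_Node by (intro cong_pre) simp_all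
  then show ?case using equiv_trans[OF _ equiv_sym[OF forest_process_single]] by simp
next
  case (3 F G)
  have "F \<parallel> G \<equiv>\<^sub>D forest_process (forest F) \<parallel> forest_process (forest G)" using 3 by (intro cong_par)
  then show ?case using equiv_trans[OF _ equiv_sym[OF forest_process_union]] by simp
qed

lemma par_copies_forest_process:
  assumes "process P" "P \<equiv>\<^sub>D forest_process M"
  shows "par_copies P (tree_process t) k \<equiv>\<^sub>D forest_process (M + replicate_mset k t)"
proof (induction k)
  case 0
  then show ?case using assms by simp
next
  case (Suc k)
  have "par_copies P (tree_process t) k \<parallel> tree_process t \<equiv>\<^sub>D forest_process (M + replicate_mset k t) \<parallel> tree_process t"
    using Suc by (intro cong_par equiv_refl) simp_all
  also have "\<dots> \<equiv>\<^sub>D tree_process t \<parallel> forest_process (M + replicate_mset k t)"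
    by (intro comm) simp_all
  also have "\<dots> \<equiv>\<^sub>D forest_process (add_mset t (M + replicate_mset k t))"
    by (rule equiv_sym[OF forest_process_add])
  finally show ?case by simp
qed

text \<open>The split behind \<open>prefix_nf\<close> is an instance of \<open>distrib\<close> read
  from left to right; the rest turns \<open>par_copies\<close> into forests.\<close>

lemma forest_process_prefix_nf: "Pre a (forest_process M) \<equiv>\<^sub>D forest_process (prefix_nf a M)"
proof -
  obtain N k where M: "M = N + replicate_mset k (Node a N)"
    and nf: "prefix_nf a M = replicate_mset (Suc k) (Node a N)"
    by (rule prefix_nf_cases[of M a])
  let ?t = "Node a N"
  have c: "par_copies (forest_process N) (tree_process ?t) k \<equiv>\<^sub>D forest_process M"
    unfolding M by (intro par_copies_forest_process equiv_refl) simp_all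
  have "Pre a (forest_process M) \<equiv>\<^sub>D Pre a (par_copies (forest_process N) (tree_process ?t) k)"
    using equiv_sym[OF c] equivD_process[OF c] by (intro cong_pre) simp_all
  also have "\<dots> \<equiv>\<^sub>D par_copies (tree_process ?t) (tree_process ?t) k"
    using distrib[of "forest_process N" a k] by (simp add: tree_process_Node)
  also have "\<dots> \<equiv>\<^sub>D forest_process ({#?t#} + replicate_mset k ?t)"
    by (intro par_copies_forest_process equiv_sym[OF forest_process_single]) simp
  finally show ?thesis by (simp add: nf)
qed

section \<open>Closure of rewriting under prefixes, replications and parallel composition\<close>

lemma rewrite_star_equivD: "P \<equiv>\<^sub>D Q \<Longrightarrow> rewrite_star T P Q"
  unfolding rewrite_star_def by auto

lemma rewrite_star_step: "rewrite_step T P Q \<Longrightarrow> rewrite_star T P Q"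
  unfolding rewrite_star_def by auto

lemma rewrite_star_refl: "rewrite_star T P P"
  unfolding rewrite_star_def by simp

lemma rewrite_star_trans [trans]: "rewrite_star T P Q \<Longrightarrow> rewrite_star T Q R \<Longrightarrow> rewrite_star T P R"
  unfolding rewrite_star_def by (rule rtranclp_trans)

lemma finite_context_of_fill: "process_context C \<Longrightarrow> finite_process (fill C F) \<Longrightarrow> finite_context C"
  by (induction rule: process_context.induct) (auto intro: finite_context.intros)

lemma finite_process_fill:
  "finite_context C \<Longrightarrow> finite_process F \<Longrightarrow> finite_process (fill C F)"
  by (induction rule: finite_context.induct) auto

lemma process_fill: "process_context C \<Longrightarrow> finite_process F \<Longrightarrow> process (fill C F)"
  by (induction rule: process_context.induct) (auto intro: process.intros finite_process_fill)

lemma rewrite_step_process: "rewrite_step T P Q \<Longrightarrow> process P \<and> process Q"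
proof (induction rule: rewrite_step.induct)
  case (B1 C F F' a)
  then show ?case by (simp add: process_fill)
next
  case (B2 F P a)
  then show ?case by simp
next
  case (mod_equivD P P' Q' Q)
  then show ?case using equivD_process by blast
qed

text \<open>Finiteness is what permits nesting: the context of a \<open>B1\<close> step in a finite
  process is itself finite and fits below a prefix or a replication, while a \<open>B2\<close> redex
  is never finite.\<close>

lemma rewrite_step_finite_process:
  "rewrite_step T P Q \<Longrightarrow> finite_process P \<Longrightarrow>
    finite_process Q \<and> rewrite_step T (Pre a P) (Pre a Q) \<and> rewrite_step T (Bang a P) (Bang a Q)"
proof (induction rule: rewrite_step.induct)
  case (B1 C F F' b)
  have C: "finite_context C" using B1 by (blast intro: finite_context_of_fill)
  have "rewrite_step T (fill (CPre a C) (Pre b F)) (fill (CPre a C) Null)"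
    using C B1(2-4) by (intro rewrite_step.B1) (auto intro: finite_context.intros process_context.intros)
  moreover have "rewrite_step T (fill (CBang a C) (Pre b F)) (fill (CBang a C) Null)"
    using C B1(2-4) by (intro rewrite_step.B1) (auto intro: finite_context.intros process_context.intros)
  ultimately show ?case using finite_process_fill[OF C] by simp
next
  case (B2 F P b)
  then show ?case by simp
next
  case (mod_equivD P P' Q' Q)
  have fin: "finite_process P'" "finite_process Q'" "finite_process Q"
    using mod_equivD equivD_process by blast+
  have PP: "Pre a P \<equiv>\<^sub>D Pre a P'" "Bang a P \<equiv>\<^sub>D Bang a P'"
    using mod_equivD(1,5) fin by (simp_all add: cong_pre cong_bang)
  have QQ: "Pre a Q' \<equiv>\<^sub>D Pre a Q" "Bang a Q' \<equiv>\<^sub>D Bang a Q"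
    using mod_equivD(3) fin by (simp_all add: cong_pre cong_bang)
  show ?case
    using rewrite_step.mod_equivD[OF PP(1) _ QQ(1)] rewrite_step.mod_equivD[OF PP(2) _ QQ(2)]
      mod_equivD(4) fin by simp
qed

lemma rewrite_star_finite_process:
  assumes "rewrite_star T P Q" "finite_process P"
  shows "finite_process Q \<and> rewrite_star T (Pre a P) (Pre a Q) \<and> rewrite_star T (Bang a P) (Bang a Q)"
  using assms unfolding rewrite_star_def
proof (induction rule: rtranclp_induct)
  case (step Q R)
  then have IH: "finite_process Q" "rewrite_star T (Pre a P) (Pre a Q)" "rewrite_star T (Bang a P) (Bang a Q)"
    by (simp_all add: rewrite_star_def)
  have "finite_process R \<and> rewrite_star T (Pre a Q) (Pre a R) \<and> rewrite_star T (Bang a Q) (Bang a R)"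
    using step(2)
  proof
    assume "Q \<equiv>\<^sub>D R"
    then show ?thesis
      using IH(1) equivD_process[of Q R] by (simp add: cong_pre cong_bang rewrite_star_equivD)
  next
    assume "rewrite_step T Q R"
    then show ?thesis
      using rewrite_step_finite_process[of T Q R a] IH(1) by (simp add: rewrite_star_step)
  qed
  then show ?case
    using rewrite_star_trans[OF IH(2)] rewrite_star_trans[OF IH(3)] by (simp add: rewrite_star_def)
qed simp

lemma rewrite_star_process: "rewrite_star T P Q \<Longrightarrow> process P \<Longrightarrow> process Q"
  unfolding rewrite_star_def
  by (induction rule: rtranclp_induct) (use equivD_process rewrite_step_process in blast)+

lemma rewrite_step_par_left: "rewrite_step T P Q \<Longrightarrow> process R \<Longrightarrow> rewrite_step T (P \<parallel> R) (Q \<parallel> R)"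
proof (induction rule: rewrite_step.induct)
  case (B1 C F F' a)
  then have "rewrite_step T (fill (CPar C R) (Pre a F)) (fill (CPar C R) Null)"
    by (intro rewrite_step.B1) (auto intro: process_context.intros)
  then show ?case by simp
next
  case (B2 F P a)
  have "(Bang a F \<parallel> Bang a F \<parallel> P) \<parallel> R \<equiv>\<^sub>D Bang a F \<parallel> ((Bang a F \<parallel> P) \<parallel> R)"
    using B2 by (intro assoc) simp_all
  also have "\<dots> \<equiv>\<^sub>D Bang a F \<parallel> Bang a F \<parallel> P \<parallel> R"
    using B2 by (intro cong_par equiv_refl assoc) simp_all
  finally have "(Bang a F \<parallel> Bang a F \<parallel> P) \<parallel> R \<equiv>\<^sub>D Bang a F \<parallel> Bang a F \<parallel> P \<parallel> R" .
  moreover have "rewrite_step T (Bang a F \<parallel> Bang a F \<parallel> P \<parallel> R) (Bang a F \<parallel> P \<parallel> R)"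
    using B2 by (intro rewrite_step.B2) simp_all
  moreover have "Bang a F \<parallel> P \<parallel> R \<equiv>\<^sub>D (Bang a F \<parallel> P) \<parallel> R"
    using B2 by (intro equiv_sym[OF assoc]) simp_all
  ultimately show ?case by (rule rewrite_step.mod_equivD)
next
  case (mod_equivD P P' Q' Q)
  then have "P \<parallel> R \<equiv>\<^sub>D P' \<parallel> R" "Q' \<parallel> R \<equiv>\<^sub>D Q \<parallel> R"
    by (simp_all add: cong_par equiv_refl)
  then show ?case using mod_equivD(4,5) rewrite_step.mod_equivD by blast
qed

lemma rewrite_star_par_left:
  "rewrite_star T P Q \<Longrightarrow> process R \<Longrightarrow> rewrite_star T (P \<parallel> R) (Q \<parallel> R)"
  unfolding rewrite_star_def
proof (induction rule: rtranclp_induct)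
  case (step Q S)
  then have "Q \<parallel> R \<equiv>\<^sub>D S \<parallel> R \<or> rewrite_step T (Q \<parallel> R) (S \<parallel> R)"
    by (auto intro: cong_par equiv_refl rewrite_step_par_left)
  with step show ?case by (simp add: rtranclp.rtrancl_into_rtrancl)
qed simp

lemma rewrite_star_par:
  assumes "rewrite_star T P P'" "rewrite_star T Q Q'" "process P" "process Q"
  shows "rewrite_star T (P \<parallel> Q) (P' \<parallel> Q')"
proof -
  have "process P'" "process Q'" using assms rewrite_star_process by blast+
  have "rewrite_star T (P \<parallel> Q) (P' \<parallel> Q)" using assms by (intro rewrite_star_par_left)
  also have "rewrite_star T (P' \<parallel> Q) (Q \<parallel> P')"
    using assms \<open>process P'\<close> by (intro rewrite_star_equivD comm)
  also have "rewrite_star T (Q \<parallel> P') (Q' \<parallel> P')" using assms \<open>process P'\<close> by (intro rewrite_star_par_left)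
  also have "rewrite_star T (Q' \<parallel> P') (P' \<parallel> Q')"
    using \<open>process Q'\<close> \<open>process P'\<close> by (intro rewrite_star_equivD comm)
  finally show ?thesis .
qed

section \<open>States as processes, and the rewriting towards them\<close>

definition bang_process :: "'a \<times> 'a tree multiset \<Rightarrow> 'a raw" where
  "bang_process = (\<lambda>(a, N). Bang a (forest_process N))"

definition bangs_process :: "('a \<times> 'a tree multiset) set \<Rightarrow> 'a raw" where
  "bangs_process U = par_mset (image_mset bang_process (mset_set U))"

lemma process_bang_process [simp]: "process (bang_process u)"
  by (simp add: bang_process_def split: prod.split)

lemma process_bangs_process [simp]: "process (bangs_process U)"
  by (simp add: bangs_process_def)

lemma bangs_process_empty [simp]: "bangs_process {} = Null"
  by (simp add: bangs_process_def)

lemma bangs_process_insert: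
  "finite U \<Longrightarrow> u \<notin> U \<Longrightarrow>
    bangs_process (insert u U) \<equiv>\<^sub>D bang_process u \<parallel> bangs_process U"
  unfolding bangs_process_def using par_mset_add[of "bang_process u" "image_mset bang_process (mset_set U)"] by simp

lemma bangs_process_member:
  assumes "finite U" "u \<in> U"
  shows "bangs_process U \<equiv>\<^sub>D bang_process u \<parallel> bangs_process (U - {u})"
  using bangs_process_insert[of "U - {u}" u] assms by (simp add: insert_absorb)

lemma bangs_process_single: "bangs_process {u} \<equiv>\<^sub>D bang_process u"
  using par_mset_single[of "bang_process u"] by (simp add: bangs_process_def)

text \<open>Distinct replicated prefixes may coincide after normalisation; \<open>B2\<close> then
  merges the duplicate.\<close>

lemma rewrite_star_bangs_process_insert:
  assumes "process T" "finite U"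
  shows "rewrite_star T (bang_process u \<parallel> bangs_process U) (bangs_process (insert u U))"
proof (cases "u \<in> U")
  case True
  obtain a N where u: "u = (a, N)" by (cases u)
  let ?R = "bangs_process (U - {u})"
  have "rewrite_star T (bang_process u \<parallel> bangs_process U) (bang_process u \<parallel> bang_process u \<parallel> ?R)"
    using bangs_process_member[OF assms(2) True] by (intro rewrite_star_equivD cong_par equiv_refl) simp_all
  also have "rewrite_star T (bang_process u \<parallel> bang_process u \<parallel> ?R) (bang_process u \<parallel> ?R)"
    using rewrite_step.B2[OF assms(1), of "forest_process N" ?R a] by (intro rewrite_star_step) (simp add: bang_process_def u)
  also have "rewrite_star T (bang_process u \<parallel> ?R) (bangs_process (insert u U))"
    using equiv_sym[OF bangs_process_member[OF assms(2) True]] True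
    by (intro rewrite_star_equivD) (simp add: insert_absorb)
  finally show ?thesis .
next
  case False
  then show ?thesis using equiv_sym[OF bangs_process_insert[OF assms(2) False]] by (intro rewrite_star_equivD)
qed

lemma rewrite_star_bangs_process_union:
  assumes "process T" "finite U" "finite V"
  shows "rewrite_star T (bangs_process U \<parallel> bangs_process V) (bangs_process (U \<union> V))"
  using assms(2)
proof (induction U rule: finite_induct)
  case empty
  then show ?case by (simp add: rewrite_star_equivD equivD_neutral_left)
next
  case (insert u U)
  have "rewrite_star T (bangs_process (insert u U) \<parallel> bangs_process V)
      ((bang_process u \<parallel> bangs_process U) \<parallel> bangs_process V)"
    using insert by (intro rewrite_star_equivD cong_par bangs_process_insert equiv_refl) simp_all
  also have "rewrite_star T ((bang_process u \<parallel> bangs_process U) \<parallel> bangs_process V)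
      (bang_process u \<parallel> (bangs_process U \<parallel> bangs_process V))"
    by (intro rewrite_star_equivD assoc) simp_all
  also have "rewrite_star T (bang_process u \<parallel> (bangs_process U \<parallel> bangs_process V))
      (bang_process u \<parallel> bangs_process (U \<union> V))"
    using insert by (intro rewrite_star_par rewrite_star_refl) simp_all
  also have "rewrite_star T (bang_process u \<parallel> bangs_process (U \<union> V)) (bangs_process (insert u (U \<union> V)))"
    using insert assms by (intro rewrite_star_bangs_process_insert) simp_all
  finally show ?case by simp
qed

definition state_process :: "'a state \<Rightarrow> 'a raw" where
  "state_process p = bangs_process (fst p) \<parallel> forest_process (snd p)"

lemma process_state_process [simp]: "process (state_process p)"
  by (simp add: state_process_def)

text \<open>\<open>absorb\<close> speaks of normalised children because a tree is erased only after
  its children have been rewritten. The rewritten process is not fixed here, so that an induction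
  over it can keep T constant.\<close>

context
  fixes E :: "'a tree set" and U :: "('a \<times> 'a tree multiset) set" and A :: "'a tree multiset" and T :: "'a raw"
  assumes fin: "finite U" and absorb: "\<And>a N. Node a N \<in> E \<Longrightarrow> (a, norm_forest E N) \<in> U"
    and T: "T = state_process (U, A)"
begin

lemma rewrite_star_erase:
  assumes "(a, N) \<in> U"
  shows "rewrite_star T (Pre a (forest_process N)) Null"
proof -
  have "T \<equiv>\<^sub>D (Bang a (forest_process N) \<parallel> bangs_process (U - {(a, N)})) \<parallel> forest_process A"
    unfolding T state_process_def using bangs_process_member[OF fin assms]
    by (intro cong_par) (simp_all add: bang_process_def equiv_refl)
  also have "\<dots> \<equiv>\<^sub>D Bang a (forest_process N) \<parallel> (bangs_process (U - {(a, N)}) \<parallel> forest_process A)"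
    by (intro assoc) simp_all
  finally have "rewrite_step T (fill Hole (Pre a (forest_process N))) (fill Hole Null)"
    by (intro rewrite_step.B1[where F' = "bangs_process (U - {(a, N)}) \<parallel> forest_process A"])
      (auto intro: process_context.intros finite_context.intros)
  then show ?thesis by (simp add: rewrite_star_step)
qed

lemma rewrite_star_norm_aux:
  "(\<And>t. t \<in># M \<Longrightarrow> rewrite_star T (tree_process t) (forest_process (norm_tree E t))) \<Longrightarrow>
    rewrite_star T (forest_process M) (forest_process (norm_forest E M))"
proof (induction M)
  case empty
  then show ?case by (simp add: rewrite_star_refl)
next
  case (add t M)
  have "rewrite_star T (forest_process (add_mset t M)) (tree_process t \<parallel> forest_process M)"
    by (intro rewrite_star_equivD forest_process_add)
  also have "rewrite_star T (tree_process t \<parallel> forest_process M)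
      (forest_process (norm_tree E t) \<parallel> forest_process (norm_forest E M))"
    using add by (intro rewrite_star_par) simp_all
  also have "rewrite_star T (forest_process (norm_tree E t) \<parallel> forest_process (norm_forest E M))
      (forest_process (norm_forest E (add_mset t M)))"
    using equiv_sym[OF forest_process_union] by (intro rewrite_star_equivD) simp
  finally show ?case .
qed

lemma rewrite_star_norm_tree: "rewrite_star T (tree_process t) (forest_process (norm_tree E t))"
proof (induction t)
  case (Node a N)
  have "rewrite_star T (forest_process N) (forest_process (norm_forest E N))" using Node by (rule rewrite_star_norm_aux)
  then have *: "rewrite_star T (tree_process (Node a N)) (Pre a (forest_process (norm_forest E N)))"
    unfolding tree_process_Node using rewrite_star_finite_process[of T "forest_process N" _ a] by simp
  show ?case
  proof (cases "Node a N \<in> E")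
    case True
    have "rewrite_star T (Pre a (forest_process (norm_forest E N))) Null" using absorb[OF True] by (rule rewrite_star_erase)
    with * show ?thesis using True rewrite_star_trans by (simp add: norm_tree_Node)
  next
    case False
    have "rewrite_star T (Pre a (forest_process (norm_forest E N))) (forest_process (prefix_nf a (norm_forest E N)))"
      by (intro rewrite_star_equivD forest_process_prefix_nf)
    with * show ?thesis using False rewrite_star_trans by (simp add: norm_tree_Node)
  qed
qed

lemma rewrite_star_norm:
  assumes "finite_process F"
  shows "rewrite_star T F (forest_process (norm_forest E (forest F)))"
proof -
  have "rewrite_star T F (forest_process (forest F))" using assms by (intro rewrite_star_equivD equivD_forest_process)
  also have "rewrite_star T (forest_process (forest F)) (forest_process (norm_forest E (forest F)))"
    by (rule rewrite_star_norm_aux) (rule rewrite_star_norm_tree)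
  finally show ?thesis .
qed

lemma rewrite_star_state_process:
  assumes "process P"
  shows "rewrite_star T P (state_process (apsnd (norm_forest E) ` bangs P, norm_forest E (forest P)))"
  using assms
proof (induction rule: process.induct)
  case (1 F)
  have "rewrite_star T F (forest_process (norm_forest E (forest F)))" using 1 by (rule rewrite_star_norm)
  also have "rewrite_star T \<dots> (Null \<parallel> \<dots>)"
    by (intro rewrite_star_equivD equiv_sym[OF equivD_neutral_left]) simp
  finally show ?case using 1 by (simp add: state_process_def bangs_finite_process)
next
  case (2 F a)
  let ?u = "(a, norm_forest E (forest F))"
  have "rewrite_star T F (forest_process (norm_forest E (forest F)))" using 2 by (rule rewrite_star_norm)
  then have "rewrite_star T (Bang a F) (bang_process ?u)"
    using rewrite_star_finite_process[of T F _ a] 2 by (simp add: bang_process_def)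
  also have "rewrite_star T (bang_process ?u) (bangs_process {?u})"
    by (intro rewrite_star_equivD equiv_sym[OF bangs_process_single])
  also have "rewrite_star T (bangs_process {?u}) (bangs_process {?u} \<parallel> Null)"
    by (intro rewrite_star_equivD equiv_sym[OF neutral]) simp
  finally show ?case by (simp add: state_process_def)
next
  case (3 P Q)
  let ?b = "\<lambda>P. apsnd (norm_forest E) ` bangs P" and ?n = "\<lambda>P. norm_forest E (forest P)"
  have "rewrite_star T (P \<parallel> Q)
      ((bangs_process (?b P) \<parallel> forest_process (?n P)) \<parallel> (bangs_process (?b Q) \<parallel> forest_process (?n Q)))"
    using 3 by (intro rewrite_star_par) (simp_all add: state_process_def)
  also have "rewrite_star T \<dots>
      ((bangs_process (?b P) \<parallel> bangs_process (?b Q)) \<parallel> (forest_process (?n P) \<parallel> forest_process (?n Q)))"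
    by (intro rewrite_star_equivD equivD_interchange) simp_all
  also have "rewrite_star T \<dots> (bangs_process (?b P \<union> ?b Q) \<parallel> forest_process (?n P + ?n Q))"
    by (intro rewrite_star_par rewrite_star_bangs_process_union rewrite_star_equivD[OF equiv_sym[OF forest_process_union]])
      (simp_all add: finite_bangs T)
  finally show ?case by (simp add: state_process_def image_Un)
qed

end

text \<open>Built only from data that \<open>bis_norm\<close> shows to be invariant, so bisimilar
  processes receive the very same term, which then serves as T for both.\<close>

definition normal_form :: "'a raw \<Rightarrow> 'a raw" where
  "normal_form P = state_process (norm_bangs (bangs P), norm_forest (absorbed (bangs P)) (forest P))"

lemma rewrite_star_normal_form:
  assumes "process P"
  shows "rewrite_star (normal_form P) P (normal_form P)"
  using rewrite_star_state_process[of "norm_bangs (bangs P)" "absorbed (bangs P)",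
      OF _ absorbed_Node_norm_bangs normal_form_def assms]
  by (simp add: normal_form_def norm_bangs_def finite_bangs)

theorem theorem2:
  fixes P Q :: "'a::countable raw"
  assumes "process P" and "process Q"
  shows "P \<bowtie> Q \<longleftrightarrow> P \<sim> Q"
proof
  assume "P \<bowtie> Q"
  then obtain T where "rewrite_star T P T" "rewrite_star T Q T"
    unfolding convertible_def by blast
  from bis_trans[OF bis_of_rewrite_star[OF this(1)] bis_sym[OF bis_of_rewrite_star[OF this(2)]]]
  show "P \<sim> Q" using assms by (simp add: bisimilar_iff_bis)
next
  assume "P \<sim> Q"
  then have "bis (bangs P, forest P) (bangs Q, forest Q)" using assms by (simp add: bisimilar_iff_bis)
  then have "normal_form P = normal_form Q"
    using bis_norm[of "bangs P" "forest P" "bangs Q" "forest Q"] by (simp add: normal_form_def)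
  then show "P \<bowtie> Q"
    using rewrite_star_normal_form[OF assms(1)] rewrite_star_normal_form[OF assms(2)]
    unfolding convertible_def by (intro exI[of _ "normal_form P"]) (simp add: normal_form_def)
qed

end
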